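(* Consider the multiple change-point model, with maximum likelihood estimators $\hat n_1,\ldots,\hat n_k,\hat\theta_1,\ldots,\hat\theta_{k+1},\hat\psi$, described in the context. Assume: (A) for each $j=1,\ldots,k$, $f_{j+1}(\psi^0,\theta_{j+1}^0;x)\neq f_j(\psi^0,\theta_j^0;x)$ on a set of $x$ of non-zero measure; (B1) for each $j=1,\ldots,k+1$, $\theta_j$ and $\theta_j^0$ are contained in $\Theta_j$, a compact subset of $\mathbb{R}^{d_j}$, and $\psi,\psi^0$ are contained in $\Psi$, a compact subset of $\mathbb{R}^d$, where $d,d_1,\ldots,d_{k+1}$ are non-negative integers; (B2) $\ell(\psi,\theta)$ is third-order continuously differentiable with respect to $\psi,\theta$; (B3) the expectations of the first and second order derivatives of $\ell^0(\psi,\theta)$ with respect to $\phi=(\psi,\theta)$ exist for $\phi$ in its parameter space; (C1) there are constants $C$ and $r<2$ such that for any $j=1,\ldots,k+1$ and any integers $s,t$ with $0\le s<t\le n$, $$E\Bigl\{\max_{\psi\in\Psi,\theta_j\in\Theta_j}\Bigl(\sum_{i=s+1}^{t}\{\log f_j(\psi,\theta_j;X_i)-E[\log f_j(\psi,\theta_j;X_i)]\}\Bigr)^2\Bigr\}\le C(t-s)^r ;$$ (C2) there are constants $D$ and $r<2$ such that for any $j=1,\ldots,k+1$ and any integers $s,t$ with $n_{j-1}^0\le s<t\le n_j^0$, $$E\Bigl\{\max_{\psi\in\Psi,\theta_j\in\Theta_j}\Bigl(\sum_{i=s+1}^{t}\{[\log f_j(\psi,\theta_j;X_i)-\log f_j(\psi^0,\theta_j^0;X_i)]-v(\psi,\theta_j;\psi^0,\theta_j^0)\}\Bigr)^2\Bigr\}\le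 D(t-s)^r .$$ Then $$\lim_{\delta\to\infty}\lim_{n\to\infty}P\bigl(n\|\hat\lambda-\lambda^0\|_\infty\ge\delta\bigr)=0,$$ where $\hat\lambda=(\hat\lambda_1,\ldots,\hat\lambda_k)$, $\hat\lambda_i=\hat n_i/n$, and $\|\hat\lambda-\lambda^0\|_\infty=\max_{1\le j\le k}|\hat\lambda_j-\lambda_j^0|$. That is, $\hat\lambda_i-\lambda_i^0=O_p(n^{-1})$ for $i=1,\ldots,k$.
   Context: Model: $k$ is a known number of change points. The (vector) observations $X_1,\ldots,X_n$ are independent, and there are unknown change points $0=n_0^0<n_1^0<\cdots<n_k^0<n_{k+1}^0=n$ such that for each $j=1,\ldots,k+1$ and $n_{j-1}^0+1\le i\le n_j^0$, $X_i$ has density $f_j(\psi^0,\theta_j^0;x)$. Here $f_j(\psi,\theta_j;x)$ is a probability density function of a continuous distribution, $\psi^0$ (possibly a vector) is an unknown parameter common to all segments, and $\theta_j^0$ is an unknown within-segment parameter (possibly vectors of different dimensions for different $j$). The functional form of $f_j$ may be the same for some or all $j$, or may differ. $\Psi$ and $\Theta_j$ are the parameter spaces of $\psi$ and $\theta_j$. Probabilities and expectations are with respect to this true model unless indicated otherwise. Put $\lambda_j^0=n_j^0/n$, $j=1,\ldots,k$; the vector $\lambda^0=(\lambda_1^0,\ldots,\lambda_k^0)$ is taken to be constant as $n\to\infty$. Write $\theta=(\theta_1,\ldots,\theta_{k+1})$ and $\phi=(\psi,\theta)$. For integers $0=n_0<n_1<\cdots<n_k<n_{k+1}=n$ let $\ell(\psi,\theta)=\sum_{j=1}^{k+1}\sum_{i=n_{j-1}+1}^{n_j}\log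 f_j(\psi,\theta_j;X_i)$ (the log-likelihood), and let $\ell^0(\psi,\theta)=\sum_{j=1}^{k+1}\sum_{i=n_{j-1}^0+1}^{n_j^0}\log f_j(\psi,\theta_j;X_i)$. The estimator $(\hat n_1,\ldots,\hat n_k,\hat\theta_1,\ldots,\hat\theta_{k+1},\hat\psi)$ is a maximizer of the log-likelihood over integers $0<n_1<\cdots<n_k<n$, $\theta_j\in\Theta_j$ ($j=1,\ldots,k+1$), $\psi\in\Psi$. For $i,j=1,\ldots,k+1$, $$v(\psi,\theta_j;\psi^0,\theta_i^0)=\int\log\Bigl[\frac{f_j(\psi,\theta_j;x)}{f_i(\psi^0,\theta_i^0;x)}\Bigr]f_i(\psi^0,\theta_i^0;x)\,dx .$$
   Formalization: The inner limit over n is read as a limit superior, since with non-unique maximizers the limit of the probabilities need not exist; this agrees with the stated limit whenever it exists and with the O_p(n^{-1}) form. *)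

theory Defs
  imports "HOL-Probability.Probability"
begin

(* R^d for an arbitrary d >= 0 (d = 0 included), as real sequences vanishing from index d on.
   The topology of "nat => real" is the product topology, which on this subspace is the
   Euclidean topology of R^d; so "compact" below has its usual meaning. *)
definition Rspace :: "nat \<Rightarrow> (nat \<Rightarrow> real) set" where
  "Rspace d = {x. \<forall>i\<ge>d. x i = 0}"

definition prob_density :: "('x::euclidean_space \<Rightarrow> real) \<Rightarrow> bool" where
  "prob_density g \<longleftrightarrow> g \<in> borel_measurable borel \<and> (\<forall>x. 0 \<le> g x) \<and>
     (\<integral>\<^sup>+x. ennreal (g x) \<partial>lborel) = 1"

(* 0 = nu_0 < nu_1 < ... < nu_k < nu_(k+1) = n *)
definition change_points :: "nat \<Rightarrow> nat \<Rightarrow> (nat \<Rightarrow> nat) \<Rightarrow> bool" where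
  "change_points k n \<nu> \<longleftrightarrow> \<nu> 0 = 0 \<and> \<nu> (k + 1) = n \<and> (\<forall>j\<le>k. \<nu> j < \<nu> (j + 1))"

(* x is the sample, observed at indices 1..n; segments are numbered j = 1..k+1. *)
definition loglik ::
  "nat \<Rightarrow> (nat \<Rightarrow> (nat \<Rightarrow> real) \<Rightarrow> (nat \<Rightarrow> real) \<Rightarrow> 'x \<Rightarrow> real) \<Rightarrow> (nat \<Rightarrow> 'x) \<Rightarrow> (nat \<Rightarrow> nat) \<Rightarrow>
    (nat \<Rightarrow> real) \<Rightarrow> (nat \<Rightarrow> nat \<Rightarrow> real) \<Rightarrow> real" where
  "loglik k f x \<nu> \<psi> \<theta> = (\<Sum>j=1..k+1. \<Sum>i=\<nu> (j-1) + 1..\<nu> j. ln (f j \<psi> (\<theta> j) (x i)))"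

definition is_MLE ::
  "nat \<Rightarrow> nat \<Rightarrow> (nat \<Rightarrow> (nat \<Rightarrow> real) \<Rightarrow> (nat \<Rightarrow> real) \<Rightarrow> 'x \<Rightarrow> real) \<Rightarrow>
    (nat \<Rightarrow> real) set \<Rightarrow> (nat \<Rightarrow> (nat \<Rightarrow> real) set) \<Rightarrow> (nat \<Rightarrow> 'x) \<Rightarrow>
    (nat \<Rightarrow> nat) \<Rightarrow> (nat \<Rightarrow> real) \<Rightarrow> (nat \<Rightarrow> nat \<Rightarrow> real) \<Rightarrow> bool" where
  "is_MLE k n f \<Psi> \<Theta> x \<nu>h \<psi>h \<theta>h \<longleftrightarrow>
     change_points k n \<nu>h \<and> \<psi>h \<in> \<Psi> \<and> (\<forall>j\<in>{1..k+1}. \<theta>h j \<in> \<Theta> j) \<and>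
     (\<forall>\<nu> \<psi> \<theta>. change_points k n \<nu> \<and> \<psi> \<in> \<Psi> \<and> (\<forall>j\<in>{1..k+1}. \<theta> j \<in> \<Theta> j) \<longrightarrow>
        loglik k f x \<nu> \<psi> \<theta> \<le> loglik k f x \<nu>h \<psi>h \<theta>h)"

(* v (psi, theta_j; psi0, theta_i0); f is indexed by j in the numerator and by i elsewhere. *)
definition vdiv ::
  "(nat \<Rightarrow> (nat \<Rightarrow> real) \<Rightarrow> (nat \<Rightarrow> real) \<Rightarrow> 'x::euclidean_space \<Rightarrow> real) \<Rightarrow> nat \<Rightarrow> nat \<Rightarrow>
    (nat \<Rightarrow> real) \<Rightarrow> (nat \<Rightarrow> real) \<Rightarrow> (nat \<Rightarrow> real) \<Rightarrow> (nat \<Rightarrow> real) \<Rightarrow> real" where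
  "vdiv f j i \<psi> \<theta>j \<psi>0 \<theta>i0 =
     (\<integral>x. ln (f j \<psi> \<theta>j x / f i \<psi>0 \<theta>i0 x) * f i \<psi>0 \<theta>i0 x \<partial>lborel)"

(* The scalar coordinates of phi = (psi, theta_1, ..., theta_(k+1)): the a-th coordinate of psi
   and the b-th coordinate of theta_j. *)
datatype coord = Psi nat | Theta nat nat

definition coords :: "nat \<Rightarrow> nat \<Rightarrow> (nat \<Rightarrow> nat) \<Rightarrow> coord set" where
  "coords k d d\<theta> = Psi ` {..<d} \<union> (\<Union>j\<in>{1..k+1}. Theta j ` {..<d\<theta> j})"

definition psi_of :: "(coord \<Rightarrow> real) \<Rightarrow> nat \<Rightarrow> real" where
  "psi_of \<phi> = (\<lambda>a. \<phi> (Psi a))"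

definition theta_of :: "(coord \<Rightarrow> real) \<Rightarrow> nat \<Rightarrow> nat \<Rightarrow> real" where
  "theta_of \<phi> = (\<lambda>j b. \<phi> (Theta j b))"

definition coord_space :: "coord set \<Rightarrow> (coord \<Rightarrow> real) set" where
  "coord_space I = {\<phi>. \<forall>c. c \<notin> I \<longrightarrow> \<phi> c = 0}"

definition param_space ::
  "nat \<Rightarrow> nat \<Rightarrow> (nat \<Rightarrow> nat) \<Rightarrow> (nat \<Rightarrow> real) set \<Rightarrow> (nat \<Rightarrow> (nat \<Rightarrow> real) set) \<Rightarrow>
    (coord \<Rightarrow> real) set" where
  "param_space k d d\<theta> \<Psi> \<Theta> =
     {\<phi> \<in> coord_space (coords k d d\<theta>). psi_of \<phi> \<in> \<Psi> \<and> (\<forall>j\<in>{1..k+1}. theta_of \<phi> j \<in> \<Theta> j)}"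

definition pd :: "coord \<Rightarrow> ((coord \<Rightarrow> real) \<Rightarrow> real) \<Rightarrow> (coord \<Rightarrow> real) \<Rightarrow> real" where
  "pd c G \<phi> = deriv (\<lambda>h. G (\<phi>(c := h))) (\<phi> c)"

(* m times continuously differentiable on the (relatively open) set U: all partial derivatives
   in the coordinates I up to order m exist and are continuous. *)
primrec Ck_on :: "nat \<Rightarrow> coord set \<Rightarrow> (coord \<Rightarrow> real) set \<Rightarrow> ((coord \<Rightarrow> real) \<Rightarrow> real) \<Rightarrow> bool" where
  "Ck_on 0 I U G \<longleftrightarrow> continuous_on U G"
| "Ck_on (Suc m) I U G \<longleftrightarrow> continuous_on U G \<and>
     (\<forall>c\<in>I. (\<forall>\<phi>\<in>U. (\<lambda>h. G (\<phi>(c := h))) differentiable at (\<phi> c)) \<and> Ck_on m I U (pd c G))"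

(* Parameter spaces are compact, hence not open, so differentiability of F on S needs a convention:
   F is C^m on S iff some G that is C^m on an open neighbourhood of S (in the coordinate space)
   agrees with F on S.  The derivatives of F at points of S are those of G. *)
definition Ck_extension ::
  "nat \<Rightarrow> coord set \<Rightarrow> (coord \<Rightarrow> real) set \<Rightarrow> ((coord \<Rightarrow> real) \<Rightarrow> real) \<Rightarrow>
    ((coord \<Rightarrow> real) \<Rightarrow> real) \<Rightarrow> bool" where
  "Ck_extension m I S F G \<longleftrightarrow>
     (\<exists>U. openin (top_of_set (coord_space I)) U \<and> S \<subseteq> U \<and> Ck_on m I U G) \<and> (\<forall>\<phi>\<in>S. G \<phi> = F \<phi>)"

definition sup_sq :: "'p set \<Rightarrow> ('p \<Rightarrow> 'w \<Rightarrow> real) \<Rightarrow> 'w \<Rightarrow> ennreal" where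
  "sup_sq P Z \<omega> = (SUP p\<in>P. ennreal ((Z p \<omega>)\<^sup>2))"

(* E { max_p Z_p^2 } <= b.  Existence of the expectation includes measurability of the supremum
   over the uncountable set P; measurability for the completion suffices, and the completion does
   not change the integral. *)
definition E_max_sq_le :: "'w measure \<Rightarrow> 'p set \<Rightarrow> ('p \<Rightarrow> 'w \<Rightarrow> real) \<Rightarrow> real \<Rightarrow> bool" where
  "E_max_sq_le M P Z b \<longleftrightarrow>
     sup_sq P Z \<in> borel_measurable (completion M) \<and> (\<integral>\<^sup>+\<omega>. sup_sq P Z \<omega> \<partial>M) \<le> ennreal b"

(* max_{1 <= j <= k} |nu_j / n - lam_j| *)
definition sup_dist :: "nat \<Rightarrow> nat \<Rightarrow> (nat \<Rightarrow> nat) \<Rightarrow> (nat \<Rightarrow> real) \<Rightarrow> real" where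
  "sup_dist k n \<nu> lam = Max ((\<lambda>j. \<bar>real (\<nu> j) / real n - lam j\<bar>) ` {1..k})"

(* Z_n = O_p(a_n) as n tends to infinity along the filter F *)
definition big_Op ::
  "nat filter \<Rightarrow> (nat \<Rightarrow> 'w measure) \<Rightarrow> (nat \<Rightarrow> 'w \<Rightarrow> real) \<Rightarrow> (nat \<Rightarrow> real) \<Rightarrow> bool" where
  "big_Op F M Z a \<longleftrightarrow>
     (\<forall>\<epsilon>>0. \<exists>K. \<forall>\<^sub>F n in F. measure (M n) {\<omega> \<in> space (M n). \<bar>Z n \<omega>\<bar> > K * a n} < \<epsilon>)"

end

theory Submission
  imports Defs
begin

text \<open>
Fix a sample. The log-likelihood is a sum of expectations plus noise. By assumption (C1) the noise of
the sum over an interval is of smaller order than its length, uniformly in the parameters. A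
dyadic maximal inequality (\<open>dyadic_maximal_inequality\<close>, \<open>deviation_tail\<close>) upgrades this to a statement
about all intervals at once: outside an event of small probability, every interval with an end point
at 0 or at a true change point carries noise of at most \<open>\<epsilon>\<close> times the maximum of its length and a
constant \<open>K\<close>, where \<open>K\<close> does not depend on \<open>n\<close> (\<open>two_sided_deviation\<close>).

The expectations provide the drift. Using a wrong density on a true segment costs the
Kullback-Leibler divergence per observation, which dominates the squared Hellinger distance
(\<open>hellinger_le_kl\<close>). By the triangle inequality for the latter, no density is close to
the two different true densities on both sides of a change point: the two divergences sum to at least a
constant \<open>c > 0\<close> (\<open>hellinger_quasi_triangle\<close>, \<open>hellinger_pos\<close>).

The rest is deterministic and compares the maximizer with two competitors. Comparison with the true
change points and true parameters shows that its total divergence is at most a small multiple of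
\<open>n\<close>. Hence each true change point has a fitted one within a small fraction of \<open>n\<close>
(\<open>change_points_near\<close>), and each fitted density has divergence at most \<open>c/4\<close> on its own true segment
(\<open>own_deficit_small\<close>). This comparison cannot give a better rate than the noise over the whole sample.
Comparison with the true change points and the \<^emph>\<open>fitted\<close> parameters can: it involves only the
observations between true and fitted change points, on which the drift is at least \<open>c/2\<close> per
observation while the noise is at most a small multiple of their number plus \<open>2 \<epsilon> K\<close>. So the fitted
change points are within a constant times \<open>K\<close> of the true ones (\<open>change_points_close\<close>).
\<close>

section \<open>Kullback-Leibler separation of neighbouring segments\<close>

lemma prob_density_integrable:
  assumes "prob_density g"
  shows "integrable lborel g" "(\<integral>x. g x \<partial>lborel) = 1"
proof -
  have "g \<in> borel_measurable lborel" "AE x in lborel. 0 \<le> g x" "(\<integral>\<^sup>+x. ennreal (g x) \<partial>lborel) = ennreal 1"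
    using assms by (auto simp: prob_density_def)
  then have "has_bochner_integral lborel g 1"
    by (intro has_bochner_integral_nn_integral) auto
  then show "integrable lborel g" "(\<integral>x. g x \<partial>lborel) = 1"
    by (auto simp: has_bochner_integral_iff)
qed

lemma hellinger_integrable:
  assumes "prob_density f" "prob_density g"
  shows "integrable lborel (\<lambda>x. (sqrt (f x) - sqrt (g x))\<^sup>2)"
proof (rule Bochner_Integration.integrable_bound)
  show "integrable lborel (\<lambda>x. f x + g x)"
    using assms by (intro Bochner_Integration.integrable_add prob_density_integrable)
  have [measurable]: "f \<in> borel_measurable borel" "g \<in> borel_measurable borel"
    using assms by (auto simp: prob_density_def)
  show "(\<lambda>x. (sqrt (f x) - sqrt (g x))\<^sup>2) \<in> borel_measurable lborel" by measurable
  have "(sqrt (f x) - sqrt (g x))\<^sup>2 \<le> f x + g x" for x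
    using assms by (simp add: prob_density_def power2_diff)
  then show "AE x in lborel. norm ((sqrt (f x) - sqrt (g x))\<^sup>2) \<le> norm (f x + g x)"
    using assms by (auto simp: prob_density_def)
qed

text \<open>The bound \<open>ln u \<le> u - 1\<close> with \<open>u = sqrt (g/f)\<close> gives, pointwise,
\<open>(sqrt f - sqrt g)\<^sup>2 + (f - g) \<le> f ln f - f ln g\<close>; the extra term \<open>f - g\<close> makes this hold
(with equality) also where \<open>f\<close> vanishes, and integrates to 0.\<close>

lemma hellinger_le_kl:
  fixes f g :: "'x::euclidean_space \<Rightarrow> real"
  assumes f: "prob_density f" and g: "prob_density g"
    and pos: "AE x in lborel. 0 < f x \<longrightarrow> 0 < g x"
    and intf: "integrable lborel (\<lambda>x. f x * ln (f x))"
    and intg: "integrable lborel (\<lambda>x. f x * ln (g x))"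
  shows "(\<integral>x. (sqrt (f x) - sqrt (g x))\<^sup>2 \<partial>lborel)
           \<le> (\<integral>x. f x * ln (f x) \<partial>lborel) - (\<integral>x. f x * ln (g x) \<partial>lborel)"
proof -
  note If = prob_density_integrable[OF f] and Ig = prob_density_integrable[OF g]
  have "(\<integral>x. (sqrt (f x) - sqrt (g x))\<^sup>2 \<partial>lborel)
      = (\<integral>x. (sqrt (f x) - sqrt (g x))\<^sup>2 + (f x - g x) \<partial>lborel)"
    using If Ig hellinger_integrable[OF f g] by simp
  also have "\<dots> \<le> (\<integral>x. f x * ln (f x) - f x * ln (g x) \<partial>lborel)"
  proof (rule integral_mono_AE)
    show "integrable lborel (\<lambda>x. (sqrt (f x) - sqrt (g x))\<^sup>2 + (f x - g x))"
      using If Ig hellinger_integrable[OF f g] by simp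
    show "integrable lborel (\<lambda>x. f x * ln (f x) - f x * ln (g x))"
      using intf intg by simp
    show "AE x in lborel. (sqrt (f x) - sqrt (g x))\<^sup>2 + (f x - g x) \<le> f x * ln (f x) - f x * ln (g x)"
      using pos
    proof eventually_elim
      case (elim x)
      have nn: "0 \<le> f x" "0 \<le> g x" using f g by (auto simp: prob_density_def)
      show ?case
      proof (cases "f x = 0")
        case True
        then show ?thesis using nn by simp
      next
        case False
        then have p: "0 < f x" "0 < g x" using nn elim by auto
        define u where "u = sqrt (g x) / sqrt (f x)"
        have "ln u \<le> u - 1" using p by (intro ln_le_minus_one) (simp add: u_def)
        moreover have "ln u = (ln (g x) - ln (f x)) / 2"
          using p by (simp add: u_def ln_div ln_sqrt)
        ultimately have "2 * f x * (1 - u) \<le> f x * (ln (f x) - ln (g x))"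
          using p by (simp add: mult.commute mult.left_commute)
        moreover have "f x * u = sqrt (f x) * sqrt (g x)"
        proof -
          have "f x = sqrt (f x) * sqrt (f x)" using p by simp
          then have "f x * u = sqrt (f x) * sqrt (f x) * u" by simp
          also have "\<dots> = sqrt (f x) * (sqrt (f x) * u)" by (simp only: mult.assoc)
          also have "sqrt (f x) * u = sqrt (g x)" using p by (simp add: u_def)
          finally show ?thesis .
        qed
        ultimately show ?thesis
          using nn by (simp add: power2_diff algebra_simps)
      qed
    qed
  qed
  also have "\<dots> = (\<integral>x. f x * ln (f x) \<partial>lborel) - (\<integral>x. f x * ln (g x) \<partial>lborel)"
    using intf intg by simp
  finally show ?thesis .
qed

text \<open>This makes one density unable to be close to two different ones, with a bound that is uniform in
\<open>g\<close>, as is needed for a density that depends on the sample.\<close>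

lemma hellinger_quasi_triangle:
  fixes f1 f2 g :: "'x::euclidean_space \<Rightarrow> real"
  assumes "prob_density f1" "prob_density f2" "prob_density g"
  shows "(\<integral>x. (sqrt (f1 x) - sqrt (f2 x))\<^sup>2 \<partial>lborel) / 2
     \<le> (\<integral>x. (sqrt (f1 x) - sqrt (g x))\<^sup>2 \<partial>lborel) + (\<integral>x. (sqrt (f2 x) - sqrt (g x))\<^sup>2 \<partial>lborel)"
proof -
  note I = hellinger_integrable[OF assms(1,3)] hellinger_integrable[OF assms(2,3)]
    hellinger_integrable[OF assms(1,2)]
  have *: "(a - b)\<^sup>2 \<le> 2 * ((a - c)\<^sup>2 + (b - c)\<^sup>2)" for a b c :: real
  proof -
    have "0 \<le> (a + b - 2 * c)\<^sup>2" by simp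
    then show ?thesis by (simp add: power2_eq_square algebra_simps)
  qed
  have "(\<integral>x. (sqrt (f1 x) - sqrt (f2 x))\<^sup>2 \<partial>lborel)
     \<le> (\<integral>x. 2 * ((sqrt (f1 x) - sqrt (g x))\<^sup>2 + (sqrt (f2 x) - sqrt (g x))\<^sup>2) \<partial>lborel)"
    using I by (intro integral_mono * integrable_mult_right Bochner_Integration.integrable_add)
  then show ?thesis using I by simp
qed

lemma hellinger_pos:
  fixes f g :: "'x::euclidean_space \<Rightarrow> real"
  assumes f: "prob_density f" and g: "prob_density g"
    and ne: "emeasure lborel {x. g x \<noteq> f x} \<noteq> 0"
  shows "0 < (\<integral>x. (sqrt (f x) - sqrt (g x))\<^sup>2 \<partial>lborel)"
proof (rule ccontr)
  assume "\<not> ?thesis"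
  moreover have "0 \<le> (\<integral>x. (sqrt (f x) - sqrt (g x))\<^sup>2 \<partial>lborel)" by (intro Bochner_Integration.integral_nonneg) simp
  ultimately have "(\<integral>x. (sqrt (f x) - sqrt (g x))\<^sup>2 \<partial>lborel) = 0" by simp
  then have "AE x in lborel. (sqrt (f x) - sqrt (g x))\<^sup>2 = 0"
    using integral_nonneg_eq_0_iff_AE[OF hellinger_integrable[OF f g]] by simp
  then have ae: "AE x in lborel. g x = f x" by eventually_elim simp
  have [measurable]: "f \<in> borel_measurable borel" "g \<in> borel_measurable borel"
    using f g by (auto simp: prob_density_def)
  have "{x \<in> space lborel. \<not> g x = f x} \<in> null_sets lborel"
    using ae by (subst (asm) AE_iff_null) auto
  then show False using ne by auto
qed

section \<open>A maximal inequality for interval-indexed deviations\<close>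

text \<open>\<open>Y a b\<close> stands for the squared deviation of the sum over the interval from \<open>a\<close> to \<open>b\<close>. Halving the
interval bounds the maximum \<open>S\<close> over \<open>2^(h+1)\<close> end points by \<open>5 Y + 5/4 (S' + S'')\<close>, where \<open>Y\<close> belongs to
the left half and \<open>S'\<close>, \<open>S''\<close> are the maxima over the two halves (a bound by the sum absorbs the
maximum of the two). The recursion closes because \<open>2 * 5/4 < 2 powr (3/2) \<le> 2 powr r\<close>, so the maximum
obeys a moment bound of the same order as a single sum. The constant 20 satisfies
\<open>5/2 * 20 + 5 = 11/4 * 20\<close>, and \<open>11/4 < 2 powr (3/2)\<close>.\<close>

lemma dyadic_maximal_inequality:
  fixes Y :: "nat \<Rightarrow> nat \<Rightarrow> 'w \<Rightarrow> ennreal"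
  assumes meas: "\<And>a b. a \<le> b \<Longrightarrow> Y a b \<in> borel_measurable M"
    and null: "\<And>a \<omega>. Y a a \<omega> = 0"
    and split: "\<And>a b c \<omega>. a \<le> b \<Longrightarrow> b \<le> c \<Longrightarrow> Y a c \<omega> \<le> 5 * Y a b \<omega> + ennreal (5/4) * Y b c \<omega>"
    and mom: "\<And>a b. a < b \<Longrightarrow> (\<integral>\<^sup>+\<omega>. Y a b \<omega> \<partial>M) \<le> ennreal (C * real (b - a) powr r)"
    and C: "0 \<le> C" and r: "3/2 \<le> r"
  shows "(\<integral>\<^sup>+\<omega>. (SUP t\<in>{a..a+2^h}. Y a t \<omega>) \<partial>M) \<le> ennreal (20 * C * (2 powr r) ^ h)"
proof (induction h arbitrary: a)
  case 0
  have "(SUP t\<in>{a..a+2^0}. Y a t \<omega>) = Y a (a + 1) \<omega>" for \<omega>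
  proof -
    have "{a..a+2^0} = {a, a + 1}" by auto
    then show ?thesis using null by (simp add: sup_absorb2)
  qed
  then show ?case
    using mom[of a "a + 1"] C by (auto intro: order_trans ennreal_leI)
next
  case (Suc h)
  define S where "S b \<omega> = (SUP t\<in>{b..b+2^h}. Y b t \<omega>)" for b \<omega>
  have S[measurable]: "S b \<in> borel_measurable M" for b
    unfolding S_def by (intro borel_measurable_SUP) (auto intro: meas)
  define m where "m = a + 2^h"
  have Yam[measurable]: "Y a m \<in> borel_measurable M" by (intro meas) (simp add: m_def)
  have le: "(SUP t\<in>{a..a+2^Suc h}. Y a t \<omega>) \<le> 5 * Y a m \<omega> + (ennreal (5/4) * S a \<omega> + ennreal (5/4) * S m \<omega>)"
    for \<omega>
  proof (rule SUP_least)
    fix t assume t: "t \<in> {a..a+2^Suc h}"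
    show "Y a t \<omega> \<le> 5 * Y a m \<omega> + (ennreal (5/4) * S a \<omega> + ennreal (5/4) * S m \<omega>)"
    proof (cases "t \<le> m")
      case True
      then have "Y a t \<omega> \<le> S a \<omega>"
        unfolding S_def using t by (intro SUP_upper) (auto simp: m_def)
      also have "\<dots> = ennreal 1 * S a \<omega>" by simp
      also have "\<dots> \<le> ennreal (5/4) * S a \<omega>"
        by (intro mult_right_mono ennreal_leI) auto
      also have "\<dots> \<le> 5 * Y a m \<omega> + (ennreal (5/4) * S a \<omega> + ennreal (5/4) * S m \<omega>)"
        by (intro order_trans[OF _ add_increasing[OF _ order_refl]] add_increasing2) auto
      finally show ?thesis .
    next
      case False
      then have "Y m t \<omega> \<le> S m \<omega>"
        unfolding S_def using t by (intro SUP_upper) (auto simp: m_def)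
      then have "5 * Y a m \<omega> + ennreal (5/4) * Y m t \<omega> \<le> 5 * Y a m \<omega> + ennreal (5/4) * S m \<omega>"
        by (intro add_left_mono mult_left_mono) auto
      also have "\<dots> \<le> 5 * Y a m \<omega> + (ennreal (5/4) * S a \<omega> + ennreal (5/4) * S m \<omega>)"
        by (intro add_left_mono add_increasing) auto
      finally show ?thesis
        using split[of a m t \<omega>] False by (auto simp: m_def intro: order_trans)
    qed
  qed
  define p where "p = (2 powr r) ^ h"
  have p0: "0 < p" by (simp add: p_def)
  have mom': "(\<integral>\<^sup>+\<omega>. Y a m \<omega> \<partial>M) \<le> ennreal (C * p)"
  proof -
    have "real (m - a) powr r = p"
      by (simp add: m_def p_def powr_powr powr_realpow[symmetric] mult.commute)
    then show ?thesis using mom[of a m] by (simp add: m_def)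
  qed
  have IH: "(\<integral>\<^sup>+\<omega>. S b \<omega> \<partial>M) \<le> ennreal (20 * C * p)" for b
    using Suc.IH[of b] by (simp add: S_def p_def)
  have "(\<integral>\<^sup>+\<omega>. (SUP t\<in>{a..a+2^Suc h}. Y a t \<omega>) \<partial>M)
      \<le> (\<integral>\<^sup>+\<omega>. 5 * Y a m \<omega> + (ennreal (5/4) * S a \<omega> + ennreal (5/4) * S m \<omega>) \<partial>M)"
    by (intro nn_integral_mono le)
  also have "\<dots> = 5 * (\<integral>\<^sup>+\<omega>. Y a m \<omega> \<partial>M)
      + (ennreal (5/4) * (\<integral>\<^sup>+\<omega>. S a \<omega> \<partial>M) + ennreal (5/4) * (\<integral>\<^sup>+\<omega>. S m \<omega> \<partial>M))"
    by (simp add: nn_integral_add nn_integral_cmult)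
  also have "\<dots> \<le> ennreal 5 * ennreal (C * p)
      + (ennreal (5/4) * ennreal (20 * C * p) + ennreal (5/4) * ennreal (20 * C * p))"
    using mom' IH by (intro add_mono mult_mono) auto
  also have "\<dots> = ennreal (55 * C * p)"
    using C p0 by (subst (1 2 3) ennreal_mult[symmetric], simp_all del: ennreal_plus add: ennreal_plus[symmetric])
  also have "\<dots> \<le> ennreal (20 * C * (2 powr r) ^ Suc h)"
  proof (rule ennreal_leI)
    have "11 / 4 \<le> (2::real) powr (3/2)"
    proof -
      have "(2::real) powr (3/2) = 2 powr (1 + 1/2)" by simp
      also have "\<dots> = 2 * sqrt 2" by (subst powr_add) (simp add: powr_half_sqrt)
      finally have e: "(2::real) powr (3/2) = 2 * sqrt 2" .
      have "11 / 8 \<le> sqrt 2" by (rule real_le_rsqrt) (simp add: power2_eq_square)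
      then show ?thesis using e by simp
    qed
    also have "\<dots> \<le> 2 powr r" using r by (intro powr_mono) auto
    finally have "11 / 4 * (20 * (C * p)) \<le> 2 powr r * (20 * (C * p))"
      using C p0 by (intro mult_right_mono) auto
    then show "55 * C * p \<le> 20 * C * (2 powr r) ^ Suc h"
      by (simp add: p_def algebra_simps)
  qed
  finally show ?case .
qed

text \<open>Markov's inequality on each dyadic scale \<open>t \<le> 2^(h0+h)\<close> costs a multiple of \<open>(2 powr r / 4)^(h0+h)\<close>.
Since \<open>r < 2\<close> these costs form a convergent geometric series, whose sum is small for large \<open>h0\<close>: all
deviations at length \<open>t\<close> are at most \<open>\<epsilon> t\<close> simultaneously, except over lengths below \<open>2^h0\<close>.\<close>

lemma deviation_tail:
  fixes Y :: "nat \<Rightarrow> nat \<Rightarrow> 'w \<Rightarrow> ennreal"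
  assumes meas: "\<And>a b. a \<le> b \<Longrightarrow> Y a b \<in> borel_measurable M"
    and null: "\<And>a \<omega>. Y a a \<omega> = 0"
    and split: "\<And>a b c \<omega>. a \<le> b \<Longrightarrow> b \<le> c \<Longrightarrow> Y a c \<omega> \<le> 5 * Y a b \<omega> + ennreal (5/4) * Y b c \<omega>"
    and mom: "\<And>a b. a < b \<Longrightarrow> (\<integral>\<^sup>+\<omega>. Y a b \<omega> \<partial>M) \<le> ennreal (C * real (b - a) powr r)"
    and C: "0 \<le> C" and r: "3/2 \<le> r" "r < 2" and \<epsilon>: "0 < \<epsilon>"
  shows "\<exists>B\<in>sets M. emeasure M B \<le> ennreal (80 * C / \<epsilon>\<^sup>2 * (2 powr r / 4) ^ h0 / (1 - 2 powr r / 4)) \<and>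
    (\<forall>\<omega>\<in>space M - B. \<forall>t. Y 0 t \<omega> \<le> ennreal ((\<epsilon> * max (real t) (2 ^ h0))\<^sup>2))"
proof -
  define q where "q = (2::real) powr r / 4"
  have "(2::real) powr r < 2 powr 2" using r by (intro powr_less_mono) auto
  then have q: "0 < q" "q < 1" by (auto simp: q_def)
  define S where "S h \<omega> = (SUP t\<in>{0..2^h}. Y 0 t \<omega>)" for h \<omega>
  have S[measurable]: "S h \<in> borel_measurable M" for h
    unfolding S_def by (intro borel_measurable_SUP) (auto intro: meas)
  have IS: "(\<integral>\<^sup>+\<omega>. S h \<omega> \<partial>M) \<le> ennreal (20 * C * (2 powr r) ^ h)" for h
    using dyadic_maximal_inequality[of Y M C r 0 h] assms by (simp add: S_def)
  define T where "T h = {\<omega> \<in> space M. 1 \<le> ennreal (4 / (\<epsilon>\<^sup>2 * 4 ^ (h0 + h))) * S (h0 + h) \<omega>}" for h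
  have T[measurable]: "T h \<in> sets M" for h unfolding T_def by measurable
  have eT: "emeasure M (T h) \<le> ennreal (80 * C / \<epsilon>\<^sup>2 * q ^ h0 * q ^ h)" for h
  proof -
    have "emeasure M (T h) \<le> ennreal (4 / (\<epsilon>\<^sup>2 * 4 ^ (h0 + h))) * (\<integral>\<^sup>+\<omega>. S (h0 + h) \<omega> \<partial>M)"
      using nn_integral_Markov_inequality[of "S (h0 + h)" "space M" M "ennreal (4 / (\<epsilon>\<^sup>2 * 4 ^ (h0 + h)))"]
      by (simp add: T_def nn_integral_cmult[symmetric] cong: nn_integral_cong)
    also have "\<dots> \<le> ennreal (4 / (\<epsilon>\<^sup>2 * 4 ^ (h0 + h))) * ennreal (20 * C * (2 powr r) ^ (h0 + h))"
      by (intro mult_left_mono IS) simp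
    also have "\<dots> = ennreal (80 * C / \<epsilon>\<^sup>2 * q ^ h0 * q ^ h)"
      using C by (simp add: ennreal_mult[symmetric] q_def power_add power_divide field_simps)
    finally show ?thesis .
  qed
  have "emeasure M (\<Union>h. T h) \<le> (\<Sum>h. emeasure M (T h))"
    by (intro emeasure_subadditive_countably) auto
  also have "\<dots> \<le> (\<Sum>h. ennreal (80 * C / \<epsilon>\<^sup>2 * q ^ h0 * q ^ h))"
    by (intro suminf_le eT) auto
  also have "\<dots> = ennreal (\<Sum>h. 80 * C / \<epsilon>\<^sup>2 * q ^ h0 * q ^ h)"
    using C q by (intro suminf_ennreal2 summable_mult summable_geometric) auto
  also have "(\<Sum>h. 80 * C / \<epsilon>\<^sup>2 * q ^ h0 * q ^ h) = 80 * C / \<epsilon>\<^sup>2 * q ^ h0 / (1 - q)"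
    using q by (subst suminf_mult) (auto simp: suminf_geometric summable_geometric)
  finally have eB: "emeasure M (\<Union>h. T h) \<le> ennreal (80 * C / \<epsilon>\<^sup>2 * q ^ h0 / (1 - q))" .
  have "Y 0 t \<omega> \<le> ennreal ((\<epsilon> * max (real t) (2 ^ h0))\<^sup>2)" if \<omega>: "\<omega> \<in> space M - (\<Union>h. T h)" for \<omega> t
  proof -
    \<comment> \<open>The smallest scale containing \<open>t\<close>: half of it is already at most \<open>max t (2^h0)\<close>.\<close>
    define h where "h = (LEAST h. t \<le> 2 ^ (h0 + h))"
    have "t \<le> 2 ^ (h0 + t)"
      by (metis le_add2 less_exp less_imp_le order_trans one_le_numeral power_increasing)
    then have t: "t \<le> 2 ^ (h0 + h)" unfolding h_def by (rule LeastI)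
    have half: "2 ^ (h0 + h) / 2 \<le> max (real t) (2 ^ h0)"
    proof (cases h)
      case 0
      have "(2::real) ^ h0 / 2 \<le> 2 ^ h0" by simp
      then show ?thesis unfolding 0 by (simp add: le_max_iff_disj)
    next
      case (Suc h')
      then have "\<not> t \<le> 2 ^ (h0 + h')" using not_less_Least[of h' "\<lambda>h. t \<le> 2 ^ (h0 + h)"] by (simp add: h_def)
      then have "2 ^ (h0 + h') < real t"
        by (simp only: not_le numeral_power_less_of_nat_cancel_iff)
      then have "2 ^ (h0 + h') \<le> max (real t) (2 ^ h0)" by (intro max.coboundedI1 less_imp_le)
      then show ?thesis using Suc by simp
    qed
    have "\<not> 1 \<le> ennreal (4 / (\<epsilon>\<^sup>2 * 4 ^ (h0 + h))) * S (h0 + h) \<omega>"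
      using \<omega> by (auto simp: T_def)
    then have lt: "ennreal (4 / (\<epsilon>\<^sup>2 * 4 ^ (h0 + h))) * S (h0 + h) \<omega> < 1" by simp
    have "S (h0 + h) \<omega> \<le> ennreal ((\<epsilon> * (2 ^ (h0 + h) / 2))\<^sup>2)"
    proof -
      define d where "d = (\<epsilon> * (2 ^ (h0 + h) / 2))\<^sup>2"
      have d: "d > 0" using \<epsilon> by (simp add: d_def)
      have four: "(4::real) ^ m = (2 ^ m)\<^sup>2" for m
        by (simp add: power_mult[symmetric] mult.commute[of m 2] power_mult)
      have "4 / (\<epsilon>\<^sup>2 * 4 ^ (h0 + h)) = 1 / d"
        by (simp add: d_def four power_mult_distrib power_divide)
      then have l: "ennreal (1/d) * S (h0 + h) \<omega> \<le> 1" using lt by simp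
      have "S (h0 + h) \<omega> = ennreal (d * (1/d)) * S (h0 + h) \<omega>" using d by simp
      also have "\<dots> = ennreal d * (ennreal (1/d) * S (h0 + h) \<omega>)"
        using d by (subst ennreal_mult) (auto simp: mult.assoc)
      also have "\<dots> \<le> ennreal d * 1" using l by (intro mult_left_mono) auto
      finally show ?thesis by (simp add: d_def)
    qed
    moreover have "Y 0 t \<omega> \<le> S (h0 + h) \<omega>" unfolding S_def using t by (intro SUP_upper) auto
    moreover have "(\<epsilon> * (2 ^ (h0 + h) / 2))\<^sup>2 \<le> (\<epsilon> * max (real t) (2 ^ h0))\<^sup>2"
      using half \<epsilon> by (intro power_mono mult_left_mono) auto
    ultimately show ?thesis by (meson ennreal_leI order_trans)
  qed
  with eB show ?thesis unfolding q_def by (intro bexI[of _ "\<Union>h. T h"]) auto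
qed

section \<open>Segmentations with controlled noise\<close>

lemma change_points_less:
  assumes "change_points k n \<nu>" "i < j" "j \<le> k + 1"
  shows "\<nu> i < \<nu> j"
  using assms(2,3)
proof (induction j)
  case (Suc j)
  have "\<nu> j < \<nu> (Suc j)" using assms(1) Suc.prems by (auto simp: change_points_def)
  then show ?case using Suc by (cases "i = j") auto
qed simp

lemma change_points_le:
  assumes "change_points k n \<nu>" "i \<le> j" "j \<le> k + 1"
  shows "\<nu> i \<le> \<nu> j"
  using change_points_less[OF assms(1), of i j] assms by (cases "i = j") auto

lemma segment_of:
  assumes cp: "change_points k n \<nu>" and t: "t \<in> {0<..n}"
  obtains i where "i \<in> {1..k+1}" "t \<in> {\<nu> (i-1)<..\<nu> i}"
proof -
  define i where "i = (LEAST i. t \<le> \<nu> i)"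
  have ex: "t \<le> \<nu> (k + 1)" using cp t by (simp add: change_points_def)
  then have 1: "t \<le> \<nu> i" unfolding i_def by (rule LeastI)
  have 2: "i \<le> k + 1" unfolding i_def using ex by (rule Least_le)
  have 3: "i \<noteq> 0" using 1 cp t by (auto simp: change_points_def intro!: gr0I)
  then have "\<not> t \<le> \<nu> (i - 1)" using not_less_Least[of "i - 1" "\<lambda>i. t \<le> \<nu> i"] by (auto simp: i_def)
  then show ?thesis using that[of i] 1 2 3 by auto
qed

lemma segment_index:
  assumes cp: "change_points k n \<nu>" and i: "i \<in> {1..k+1}" and t: "t \<in> {\<nu> (i-1)<..\<nu> i}"
  shows "(LEAST i. t \<le> \<nu> i) = i"
proof (rule Least_equality)
  show "t \<le> \<nu> i" using t by simp
  fix j assume j: "t \<le> \<nu> j"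
  show "i \<le> j"
  proof (rule ccontr)
    assume "\<not> i \<le> j"
    then have "\<nu> j \<le> \<nu> (i - 1)" using i by (intro change_points_le[OF cp]) auto
    then show False using t j by simp
  qed
qed

lemma sum_interval_split:
  fixes g :: "nat \<Rightarrow> real"
  assumes "a \<le> b" "b \<le> c"
  shows "sum g {a<..c} = sum g {a<..b} + sum g {b<..c}"
proof -
  have "{a<..c} = {a<..b} \<union> {b<..c}" using assms by auto
  then show ?thesis by (simp add: sum.union_disjoint)
qed

lemma sum_over_segments:
  fixes g :: "nat \<Rightarrow> real"
  assumes cp: "change_points k n \<nu>"
  shows "(\<Sum>j=1..k+1. sum g {\<nu> (j-1)<..\<nu> j}) = sum g {0<..n}"
proof -
  have "(\<Sum>j=1..m. sum g {\<nu> (j-1)<..\<nu> j}) = sum g {0<..\<nu> m}" if "m \<le> k + 1" for m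
    using that
  proof (induction m)
    case 0
    then show ?case using cp by (simp add: change_points_def)
  next
    case (Suc m)
    then show ?case
      using sum_interval_split[of 0 "\<nu> m" "\<nu> (Suc m)" g] change_points_le[OF cp, of m "Suc m"] by simp
  qed
  from this[of "k+1"] show ?thesis using cp by (simp add: change_points_def)
qed

text \<open>Moving the change points while keeping the segment functions \<open>F j\<close> only affects the observations
between each old change point and the new one, which pass from \<open>F (i+1)\<close> to \<open>F i\<close> or back.
Written with prefix sums, the identity covers both directions of the move at once.\<close>

lemma segmentation_difference:
  fixes F :: "nat \<Rightarrow> nat \<Rightarrow> real"
  assumes \<nu>: "change_points k n \<nu>" and \<nu>0: "change_points k n \<nu>0"
  shows "(\<Sum>j=1..k+1. sum (F j) {\<nu> (j-1)<..\<nu> j}) - (\<Sum>j=1..k+1. sum (F j) {\<nu>0 (j-1)<..\<nu>0 j})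
    = (\<Sum>i=1..k. (sum (F i) {0<..\<nu> i} - sum (F i) {0<..\<nu>0 i})
                 - (sum (F (i+1)) {0<..\<nu> i} - sum (F (i+1)) {0<..\<nu>0 i}))"
proof -
  have tel: "(\<Sum>j=1..k+1. sum (F j) {\<nu> (j-1)<..\<nu> j})
     = (\<Sum>i=1..k. sum (F i) {0<..\<nu> i} - sum (F (i+1)) {0<..\<nu> i}) + sum (F (k+1)) {0<..n}"
    if cp: "change_points k n \<nu>" for \<nu>
  proof -
    have piece: "sum g {\<nu> (j-1)<..\<nu> j} = sum g {0<..\<nu> j} - sum g {0<..\<nu> (j-1)}"
      if "j \<in> {1..k+1}" for j and g :: "nat \<Rightarrow> real"
      using sum_interval_split[of 0 "\<nu> (j-1)" "\<nu> j" g] change_points_le[OF cp, of "j-1" j] that by simp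
    have tel': "(\<Sum>j=1..m+1. sum (F j) {0<..\<nu> j} - sum (F j) {0<..\<nu> (j-1)})
     = (\<Sum>i=1..m. sum (F i) {0<..\<nu> i} - sum (F (i+1)) {0<..\<nu> i}) + sum (F (m+1)) {0<..\<nu> (m+1)}" for m
      using cp by (induction m) (simp_all add: change_points_def)
    have "(\<Sum>j=1..k+1. sum (F j) {\<nu> (j-1)<..\<nu> j})
       = (\<Sum>j=1..k+1. sum (F j) {0<..\<nu> j} - sum (F j) {0<..\<nu> (j-1)})"
      using piece by (intro sum.cong) auto
    also note tel'[of k]
    finally show ?thesis using cp by (simp add: change_points_def)
  qed
  show ?thesis
    unfolding tel[OF \<nu>] tel[OF \<nu>0] by (simp add: sum_subtractf)
qed

lemma strictly_increasing_selfmap: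
  fixes J :: "nat \<Rightarrow> nat"
  assumes range: "\<And>i. i \<in> {1..k} \<Longrightarrow> J i \<in> {1..k}"
    and step: "\<And>i. 1 \<le> i \<Longrightarrow> i < k \<Longrightarrow> J i < J (i+1)"
    and i: "i \<in> {1..k}"
  shows "J i = i"
proof -
  have lo: "i \<le> J i" if "i \<in> {1..k}" for i
    using that
  proof (induction i)
    case (Suc i)
    show ?case
    proof (cases "i = 0")
      case True
      then show ?thesis using range[of 1] Suc by auto
    next
      case False
      then have "i \<le> J i" "J i < J (i+1)" using Suc step[of i] by auto
      then show ?thesis by simp
    qed
  qed simp
  have hi: "J (k - m) \<le> k - m" if "m < k" for m
    using that
  proof (induction m)
    case 0
    then show ?case using range[of k] by auto
  next
    case (Suc m)
    then have "J (k - Suc m) < J (k - Suc m + 1)" by (intro step) auto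
    also have "k - Suc m + 1 = k - m" using Suc by simp
    finally show ?case using Suc by simp
  qed
  show ?thesis using lo[OF i] hi[of "k - i"] i by auto
qed

text \<open>A deterministic description of the samples on which the estimator behaves well. \<open>L j p t\<close> is the
log-density of observation \<open>t\<close> under model \<open>j\<close> with parameter \<open>p\<close>, \<open>\<mu> j p t\<close> its expectation, and
\<open>\<mu>0 t\<close> the expectation of the true log-density. The deficit \<open>\<kappa> j p i\<close> is a Kullback-Leibler
divergence: the expected loss per observation when model \<open>j\<close> with parameter \<open>p\<close> is used on the \<open>i\<close>-th
true segment. The noise over intervals that start or end at a true change point (or at 0) is at
most \<open>\<epsilon>\<close> times their length, uniformly in the parameters, once the length reaches \<open>K\<close>.\<close>

locale controlled_noise =
  fixes k n :: nat and \<nu>0 :: "nat \<Rightarrow> nat" and P :: "nat \<Rightarrow> 'p set"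
    and L \<mu> :: "nat \<Rightarrow> 'p \<Rightarrow> nat \<Rightarrow> real"
    and \<mu>0 :: "nat \<Rightarrow> real" and \<kappa> :: "nat \<Rightarrow> 'p \<Rightarrow> nat \<Rightarrow> real" and p0 :: "nat \<Rightarrow> 'p"
    and c \<epsilon> K :: real
  assumes cp0: "change_points k n \<nu>0"
    and p0: "\<And>j. j \<in> {1..k+1} \<Longrightarrow> p0 j \<in> P j"
    and mean: "\<And>j p i t. j \<in> {1..k+1} \<Longrightarrow> p \<in> P j \<Longrightarrow> i \<in> {1..k+1} \<Longrightarrow> t \<in> {\<nu>0 (i-1)<..\<nu>0 i} \<Longrightarrow>
        \<mu> j p t = \<mu>0 t - \<kappa> j p i"
    and deficit_truth: "\<And>j. j \<in> {1..k+1} \<Longrightarrow> \<kappa> j (p0 j) j = 0"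
    and deficit_nonneg: "\<And>j p i. j \<in> {1..k+1} \<Longrightarrow> p \<in> P j \<Longrightarrow> i \<in> {1..k+1} \<Longrightarrow> 0 \<le> \<kappa> j p i"
    and separation: "\<And>j p i. j \<in> {1..k+1} \<Longrightarrow> p \<in> P j \<Longrightarrow> i \<in> {1..k} \<Longrightarrow> c \<le> \<kappa> j p i + \<kappa> j p (i+1)"
    and noise_right: "\<And>j p l b. j \<in> {1..k+1} \<Longrightarrow> p \<in> P j \<Longrightarrow> l \<le> k \<Longrightarrow> \<nu>0 l \<le> b \<Longrightarrow> b \<le> n \<Longrightarrow>
        \<bar>\<Sum>t\<in>{\<nu>0 l<..b}. L j p t - \<mu> j p t\<bar> \<le> \<epsilon> * max (real (b - \<nu>0 l)) K"
    and noise_left: "\<And>j p l a. j \<in> {1..k+1} \<Longrightarrow> p \<in> P j \<Longrightarrow> l \<le> k \<Longrightarrow> a \<le> \<nu>0 l \<Longrightarrow>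
        \<bar>\<Sum>t\<in>{a<..\<nu>0 l}. L j p t - \<mu> j p t\<bar> \<le> \<epsilon> * max (real (\<nu>0 l - a)) K"
    and c: "0 < c" and \<epsilon>: "0 < \<epsilon>" and K: "0 \<le> K" "K \<le> real n"
begin

lemma noise_anywhere:
  assumes "j \<in> {1..k+1}" "p \<in> P j" "a \<le> b" "b \<le> n"
  shows "\<bar>\<Sum>t\<in>{a<..b}. L j p t - \<mu> j p t\<bar> \<le> 2 * \<epsilon> * real n"
proof -
  have *: "\<bar>\<Sum>t\<in>{0<..m}. L j p t - \<mu> j p t\<bar> \<le> \<epsilon> * real n" if "m \<le> n" for m
  proof -
    have "\<bar>\<Sum>t\<in>{0<..m}. L j p t - \<mu> j p t\<bar> \<le> \<epsilon> * max (real m) K"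
      using noise_right[of j p 0 m] assms that cp0 by (simp add: change_points_def)
    also have "\<dots> \<le> \<epsilon> * real n" using \<epsilon> K that by (intro mult_left_mono) auto
    finally show ?thesis .
  qed
  show ?thesis
    using *[of a] *[of b] assms sum_interval_split[of 0 a b "\<lambda>t. L j p t - \<mu> j p t"] by simp
qed

lemma mean_le:
  assumes j: "j \<in> {1..k+1}" "p \<in> P j" and t: "t \<in> {0<..n}"
  shows "\<mu> j p t \<le> \<mu>0 t"
proof -
  obtain i where "i \<in> {1..k+1}" "t \<in> {\<nu>0 (i-1)<..\<nu>0 i}" using segment_of[OF cp0 t] .
  then show ?thesis using mean[of j p i t] deficit_nonneg[of j p i] j by simp
qed

lemma mean_truth: "\<mu> j (p0 j) t = \<mu>0 t" if "j \<in> {1..k+1}" "t \<in> {\<nu>0 (j-1)<..\<nu>0 j}"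
  using mean[OF that(1) p0[OF that(1)] that(1) that(2)] deficit_truth[OF that(1)] by simp

text \<open>Each of the \<open>k+1\<close> segments of the two segmentations contributes noise of at most \<open>2 \<epsilon> n\<close>, and the
expectations of the two sides differ by exactly the accumulated deficit. So a fit that is at least
as good as the truth has a deficit that is small compared with \<open>n\<close>.\<close>

lemma total_deficit:
  assumes cp: "change_points k n \<nu>" and q: "\<And>j. j \<in> {1..k+1} \<Longrightarrow> q j \<in> P j"
    and ge: "(\<Sum>j=1..k+1. sum (L j (p0 j)) {\<nu>0 (j-1)<..\<nu>0 j}) \<le> (\<Sum>j=1..k+1. sum (L j (q j)) {\<nu> (j-1)<..\<nu> j})"
  shows "(\<Sum>j=1..k+1. \<Sum>t\<in>{\<nu> (j-1)<..\<nu> j}. \<mu>0 t - \<mu> j (q j) t) \<le> 4 * real (k+1) * \<epsilon> * real n"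
proof -
  have in_n: "\<nu> (j-1) \<le> \<nu> j" "\<nu> j \<le> n" if "j \<in> {1..k+1}" "change_points k n \<nu>" for j \<nu>
    using change_points_le[OF that(2), of "j-1" j] change_points_le[OF that(2), of j "k+1"] that
    by (auto simp: change_points_def)
  have up: "(\<Sum>j=1..k+1. sum (L j (q j)) {\<nu> (j-1)<..\<nu> j})
      \<le> (\<Sum>j=1..k+1. sum (\<mu> j (q j)) {\<nu> (j-1)<..\<nu> j} + 2 * \<epsilon> * real n)"
  proof (rule sum_mono)
    fix j assume j: "j \<in> {1..k+1}"
    have "\<bar>\<Sum>t\<in>{\<nu> (j-1)<..\<nu> j}. L j (q j) t - \<mu> j (q j) t\<bar> \<le> 2 * \<epsilon> * real n"
      using j q in_n[OF j cp] by (intro noise_anywhere) auto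
    then show "sum (L j (q j)) {\<nu> (j-1)<..\<nu> j} \<le> sum (\<mu> j (q j)) {\<nu> (j-1)<..\<nu> j} + 2 * \<epsilon> * real n"
      by (simp add: sum_subtractf)
  qed
  have low: "(\<Sum>j=1..k+1. sum \<mu>0 {\<nu>0 (j-1)<..\<nu>0 j} - 2 * \<epsilon> * real n)
      \<le> (\<Sum>j=1..k+1. sum (L j (p0 j)) {\<nu>0 (j-1)<..\<nu>0 j})"
  proof (rule sum_mono)
    fix j assume j: "j \<in> {1..k+1}"
    have "\<bar>\<Sum>t\<in>{\<nu>0 (j-1)<..\<nu>0 j}. L j (p0 j) t - \<mu> j (p0 j) t\<bar> \<le> 2 * \<epsilon> * real n"
      using j p0 in_n[OF j cp0] by (intro noise_anywhere) auto
    moreover have "(\<Sum>t\<in>{\<nu>0 (j-1)<..\<nu>0 j}. \<mu> j (p0 j) t) = sum \<mu>0 {\<nu>0 (j-1)<..\<nu>0 j}"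
      using mean_truth[OF j] by (intro sum.cong) auto
    ultimately show "sum \<mu>0 {\<nu>0 (j-1)<..\<nu>0 j} - 2 * \<epsilon> * real n \<le> sum (L j (p0 j)) {\<nu>0 (j-1)<..\<nu>0 j}"
      by (simp add: sum_subtractf)
  qed
  have "(\<Sum>j=1..k+1. \<Sum>t\<in>{\<nu> (j-1)<..\<nu> j}. \<mu>0 t - \<mu> j (q j) t)
     = sum \<mu>0 {0<..n} - (\<Sum>j=1..k+1. sum (\<mu> j (q j)) {\<nu> (j-1)<..\<nu> j})"
    using sum_over_segments[OF cp, of \<mu>0] by (simp only: sum_subtractf)
  also have "sum \<mu>0 {0<..n} = (\<Sum>j=1..k+1. sum \<mu>0 {\<nu>0 (j-1)<..\<nu>0 j} - 2 * \<epsilon> * real n)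
      + real (k+1) * (2 * \<epsilon> * real n)"
    using sum_over_segments[OF cp0, of \<mu>0] by (simp only: sum_subtractf sum_constant) simp
  also have "(\<Sum>j=1..k+1. sum (\<mu> j (q j)) {\<nu> (j-1)<..\<nu> j})
     = (\<Sum>j=1..k+1. sum (\<mu> j (q j)) {\<nu> (j-1)<..\<nu> j} + 2 * \<epsilon> * real n) - real (k+1) * (2 * \<epsilon> * real n)"
    by (simp only: sum.distrib sum_constant) simp
  finally show ?thesis using up low ge by (simp add: algebra_simps)
qed

lemma partial_deficit:
  assumes cp: "change_points k n \<nu>" and q: "\<And>j. j \<in> {1..k+1} \<Longrightarrow> q j \<in> P j"
    and j: "j \<in> {1..k+1}" and ab: "\<nu> (j-1) \<le> a" "b \<le> \<nu> j"
  shows "(\<Sum>t\<in>{a<..b}. \<mu>0 t - \<mu> j (q j) t)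
      \<le> (\<Sum>j=1..k+1. \<Sum>t\<in>{\<nu> (j-1)<..\<nu> j}. \<mu>0 t - \<mu> j (q j) t)"
proof -
  have in_n: "\<nu> j \<le> n" if "j \<in> {1..k+1}" for j
    using change_points_le[OF cp, of j "k+1"] that cp by (auto simp: change_points_def)
  have nn: "0 \<le> \<mu>0 t - \<mu> j (q j) t" if "j \<in> {1..k+1}" "t \<in> {\<nu> (j-1)<..\<nu> j}" for j t
    using mean_le[of j "q j" t] that q in_n[OF that(1)] by auto
  have "(\<Sum>t\<in>{a<..b}. \<mu>0 t - \<mu> j (q j) t) \<le> (\<Sum>t\<in>{\<nu> (j-1)<..\<nu> j}. \<mu>0 t - \<mu> j (q j) t)"
    using ab nn[OF j] by (intro sum_mono2) auto
  also have "\<dots> \<le> (\<Sum>j=1..k+1. \<Sum>t\<in>{\<nu> (j-1)<..\<nu> j}. \<mu>0 t - \<mu> j (q j) t)"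
    using j nn by (intro member_le_sum[where f="\<lambda>j. \<Sum>t\<in>{\<nu> (j-1)<..\<nu> j}. \<mu>0 t - \<mu> j (q j) t"] sum_nonneg) auto
  finally show ?thesis .
qed

lemma deficit_on_true_segment:
  assumes "j \<in> {1..k+1}" "p \<in> P j" "i \<in> {1..k+1}" "\<nu>0 (i-1) \<le> a" "a \<le> b" "b \<le> \<nu>0 i"
  shows "(\<Sum>t\<in>{a<..b}. \<mu>0 t - \<mu> j p t) = real (b - a) * \<kappa> j p i"
proof -
  have "(\<Sum>t\<in>{a<..b}. \<mu>0 t - \<mu> j p t) = (\<Sum>t\<in>{a<..b}. \<kappa> j p i)"
    using assms by (intro sum.cong) (auto simp: mean)
  then show ?thesis using assms by simp
qed

text \<open>From here on, \<open>\<nu>\<close> and \<open>q\<close> are a segmentation and segment parameters that fit at least as well as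
the truth. The length \<open>R\<close> is a resolution proportional to \<open>n\<close>: true segments are at least four
times longer, while the total deficit of the fit is at most half of the deficit \<open>c R\<close> that is caused
by missing a change point by \<open>R\<close>.\<close>

context
  fixes \<nu> :: "nat \<Rightarrow> nat" and q :: "nat \<Rightarrow> 'p" and R :: nat
  assumes cp: "change_points k n \<nu>" and q: "\<And>j. j \<in> {1..k+1} \<Longrightarrow> q j \<in> P j"
    and beats_truth: "(\<Sum>j=1..k+1. sum (L j (p0 j)) {\<nu>0 (j-1)<..\<nu>0 j})
                      \<le> (\<Sum>j=1..k+1. sum (L j (q j)) {\<nu> (j-1)<..\<nu> j})"
    and R: "1 \<le> R" and gap: "\<And>i. i \<le> k \<Longrightarrow> \<nu>0 i + 4 * R \<le> \<nu>0 (i+1)"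
    and small: "8 * real (k+1) * \<epsilon> * real n \<le> c * real R"
begin

lemma half_deficit:
  assumes "j \<in> {1..k+1}" "\<nu> (j-1) \<le> a" "b \<le> \<nu> j"
  shows "(\<Sum>t\<in>{a<..b}. \<mu>0 t - \<mu> j (q j) t) \<le> c * real R / 2"
proof -
  note partial_deficit[where \<nu>=\<nu> and q=q, OF cp q assms]
  also note total_deficit[where \<nu>=\<nu> and q=q, OF cp q beats_truth]
  finally show ?thesis using small by (simp add: algebra_simps)
qed

text \<open>Otherwise one fitted segment contains \<open>R\<close> observations on each side of a true change point, and by
separation its single parameter has a deficit of at least \<open>c R\<close> there.\<close>

lemma some_change_point_near:
  assumes i: "i \<in> {1..k}"
  shows "\<exists>j\<in>{1..k}. \<nu> j \<le> \<nu>0 i + R \<and> \<nu>0 i \<le> \<nu> j + R"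
proof (rule ccontr)
  assume no: "\<not> ?thesis"
  have g1: "\<nu>0 (i-1) + 4 * R \<le> \<nu>0 i" using gap[of "i-1"] i by (cases i) auto
  have g2: "\<nu>0 i + 4 * R \<le> \<nu>0 (i+1)" using gap[of i] i by simp
  have "\<nu>0 (i+1) \<le> n"
    using change_points_le[OF cp0, of "i+1" "k+1"] i cp0 by (auto simp: change_points_def)
  then have "\<nu>0 i \<in> {0<..n}" using g1 g2 R by auto
  then obtain j where j: "j \<in> {1..k+1}" "\<nu>0 i \<in> {\<nu> (j-1)<..\<nu> j}" using segment_of[OF cp] by blast
  have lo: "\<nu> (j-1) \<le> \<nu>0 i - R"
  proof (cases "j = 1")
    case True
    then show ?thesis using cp by (simp add: change_points_def)
  next
    case False
    then have "j - 1 \<in> {1..k}" using j by auto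
    then have "\<not> (\<nu> (j-1) \<le> \<nu>0 i + R \<and> \<nu>0 i \<le> \<nu> (j-1) + R)" using no by blast
    then show ?thesis using j by auto
  qed
  have hi: "\<nu>0 i + R \<le> \<nu> j"
  proof (cases "j = k + 1")
    case True
    then have "\<nu> j = n" using cp by (simp add: change_points_def)
    then show ?thesis using g2 \<open>\<nu>0 (i+1) \<le> n\<close> by simp
  next
    case False
    then have "j \<in> {1..k}" using j by auto
    then have "\<not> (\<nu> j \<le> \<nu>0 i + R \<and> \<nu>0 i \<le> \<nu> j + R)" using no by blast
    then show ?thesis using j by auto
  qed
  have "real R * \<kappa> j (q j) i + real R * \<kappa> j (q j) (i+1)
     = (\<Sum>t\<in>{\<nu>0 i - R<..\<nu>0 i}. \<mu>0 t - \<mu> j (q j) t) + (\<Sum>t\<in>{\<nu>0 i<..\<nu>0 i + R}. \<mu>0 t - \<mu> j (q j) t)"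
    using i j q g1 g2 by (subst (1 2) deficit_on_true_segment[of j "q j"]) auto
  also have "\<dots> = (\<Sum>t\<in>{\<nu>0 i - R<..\<nu>0 i + R}. \<mu>0 t - \<mu> j (q j) t)"
    by (subst sum_interval_split[of "\<nu>0 i - R" "\<nu>0 i"]) auto
  also have "\<dots> \<le> c * real R / 2" by (rule half_deficit) fact+
  finally have "real R * (\<kappa> j (q j) i + \<kappa> j (q j) (i+1)) \<le> c * real R / 2" by (simp add: algebra_simps)
  moreover have "real R * c \<le> real R * (\<kappa> j (q j) i + \<kappa> j (q j) (i+1))"
    using i j q by (intro mult_left_mono separation) auto
  moreover have "0 < c * real R" using c R by simp
  ultimately show False by (simp add: mult.commute)
qed

text \<open>The fitted change points near different true ones are different and in the same order, and there
are \<open>k\<close> of each, so the \<open>i\<close>-th is near the \<open>i\<close>-th.\<close>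

lemma change_points_near:
  assumes i: "i \<in> {1..k}"
  shows "\<nu> i \<le> \<nu>0 i + R \<and> \<nu>0 i \<le> \<nu> i + R"
proof -
  obtain J where J: "\<And>i. i \<in> {1..k} \<Longrightarrow> J i \<in> {1..k} \<and> \<nu> (J i) \<le> \<nu>0 i + R \<and> \<nu>0 i \<le> \<nu> (J i) + R"
    using some_change_point_near by metis
  have "J i = i"
  proof (rule strictly_increasing_selfmap[where k=k])
    fix i assume i: "1 \<le> i" "i < k"
    show "J i < J (i+1)"
    proof (rule ccontr)
      assume "\<not> J i < J (i+1)"
      then have "\<nu> (J (i+1)) \<le> \<nu> (J i)"
        using J[of i] i by (intro change_points_le[OF cp]) auto
      then show False using J[of i] J[of "i+1"] gap[of i] R i by simp
    qed
  qed (use J i in auto)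
  then show ?thesis using J[OF i] by simp
qed

text \<open>A fitted segment shares at least \<open>2 R\<close> observations with the true segment of the same index.\<close>

lemma own_deficit_small:
  assumes j: "j \<in> {1..k+1}"
  shows "\<kappa> j (q j) j \<le> c / 4"
proof -
  have lo: "\<nu> (j-1) \<le> \<nu>0 (j-1) + R"
  proof (cases "j = 1")
    case True
    then show ?thesis using cp by (simp add: change_points_def)
  next
    case False
    then show ?thesis using change_points_near[of "j-1"] j by (cases j) auto
  qed
  have hi: "\<nu>0 j - R \<le> \<nu> j"
  proof (cases "j = k+1")
    case True
    then show ?thesis using cp cp0 by (simp add: change_points_def)
  next
    case False
    then show ?thesis using change_points_near[of j] j by auto
  qed
  have g: "\<nu>0 (j-1) + 4 * R \<le> \<nu>0 j" using gap[of "j-1"] j by auto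
  have kn: "0 \<le> \<kappa> j (q j) j" using j q by (intro deficit_nonneg) auto
  have "2 * real R * \<kappa> j (q j) j \<le> real ((\<nu>0 j - R) - (\<nu>0 (j-1) + R)) * \<kappa> j (q j) j"
    using g kn by (intro mult_right_mono) auto
  also have "\<dots> = (\<Sum>t\<in>{\<nu>0 (j-1) + R<..\<nu>0 j - R}. \<mu>0 t - \<mu> j (q j) t)"
    using g j q by (subst deficit_on_true_segment[where i=j]) auto
  also have "\<dots> \<le> c * real R / 2" using j lo hi by (rule half_deficit)
  finally have "real R * \<kappa> j (q j) j \<le> real R * (c / 4)" by (simp add: mult.commute)
  then show ?thesis using R by (subst (asm) mult_le_cancel_left_pos) auto
qed

text \<open>Observations between the \<open>i\<close>-th true and fitted change points all belong to one true segment, the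
\<open>i\<close>-th or the next. On it, the parameter of that segment has a deficit of at most \<open>c/4\<close>, hence by
separation the parameter of the neighbour has one of at least \<open>3c/4\<close>. Misplacing the change point by
\<open>m\<close> therefore costs \<open>m c/2\<close> in expectation, against noise of at most \<open>2 \<epsilon> (m + K)\<close>.\<close>

lemma relocation_gain:
  assumes i: "i \<in> {1..k}" and ec: "\<epsilon> \<le> c / 8"
  shows "(sum (L i (q i)) {0<..\<nu> i} - sum (L i (q i)) {0<..\<nu>0 i})
       - (sum (L (i+1) (q (i+1))) {0<..\<nu> i} - sum (L (i+1) (q (i+1))) {0<..\<nu>0 i})
       \<le> 2 * \<epsilon> * K - c / 4 * \<bar>real (\<nu> i) - real (\<nu>0 i)\<bar>" (is "?D \<le> _")
proof -
  have mem: "i \<in> {1..k+1}" "i + 1 \<in> {1..k+1}" using i by auto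
  have qq: "q i \<in> P i" "q (i+1) \<in> P (i+1)" using q mem by auto
  have near: "\<nu> i \<le> \<nu>0 i + R" "\<nu>0 i \<le> \<nu> i + R" using change_points_near[OF i] by auto
  have g1: "\<nu>0 (i-1) + 4 * R \<le> \<nu>0 i" using gap[of "i-1"] i by (cases i) auto
  have g2: "\<nu>0 i + 4 * R \<le> \<nu>0 (i+1)" using gap[of i] i by simp
  have own: "\<kappa> i (q i) i \<le> c/4" "\<kappa> (i+1) (q (i+1)) (i+1) \<le> c/4"
    using own_deficit_small mem by auto
  have sep: "c \<le> \<kappa> i (q i) i + \<kappa> i (q i) (i+1)" "c \<le> \<kappa> (i+1) (q (i+1)) i + \<kappa> (i+1) (q (i+1)) (i+1)"
    using separation mem qq i by auto
  have dec: "sum (L j p) S = sum \<mu>0 S - (\<Sum>t\<in>S. \<mu>0 t - \<mu> j p t) + (\<Sum>t\<in>S. L j p t - \<mu> j p t)" for j p S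
    by (simp add: sum_subtractf)
  define m where "m = \<bar>real (\<nu> i) - real (\<nu>0 i)\<bar>"
  have m0: "0 \<le> m" by (simp add: m_def)
  have key: "?D \<le> 2 * (\<epsilon> * max m K) - m * (c / 2)"
  proof (cases "\<nu>0 i \<le> \<nu> i")
    case True
    have m: "m = real (\<nu> i - \<nu>0 i)" using True by (simp add: m_def)
    have in_n: "\<nu> i \<le> n" using change_points_le[OF cp, of i "k+1"] i cp by (auto simp: change_points_def)
    let ?S = "{\<nu>0 i<..\<nu> i}"
    have "?D = sum (L i (q i)) ?S - sum (L (i+1) (q (i+1))) ?S"
      using True sum_interval_split[of 0 "\<nu>0 i" "\<nu> i"] by simp
    also have "\<dots> = m * \<kappa> (i+1) (q (i+1)) (i+1) - m * \<kappa> i (q i) (i+1)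
        + (\<Sum>t\<in>?S. L i (q i) t - \<mu> i (q i) t) - (\<Sum>t\<in>?S. L (i+1) (q (i+1)) t - \<mu> (i+1) (q (i+1)) t)"
      unfolding dec[of i] dec[of "i+1"]
      using True near g2 mem qq by (subst (1 2) deficit_on_true_segment[where i="i+1"]) (auto simp: m)
    also have "\<dots> \<le> m * \<kappa> (i+1) (q (i+1)) (i+1) - m * \<kappa> i (q i) (i+1) + 2 * (\<epsilon> * max m K)"
      using noise_right[of i "q i" i "\<nu> i"] noise_right[of "i+1" "q (i+1)" i "\<nu> i"] mem qq i True in_n
      by (auto simp: m)
    also have "m * \<kappa> (i+1) (q (i+1)) (i+1) - m * \<kappa> i (q i) (i+1) \<le> - (m * (c / 2))"
    proof -
      have "m * (\<kappa> (i+1) (q (i+1)) (i+1) - \<kappa> i (q i) (i+1)) \<le> m * (- (c / 2))"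
        using own sep m0 by (intro mult_left_mono) auto
      then show ?thesis by (simp add: algebra_simps)
    qed
    finally show ?thesis by simp
  next
    case False
    have m: "m = real (\<nu>0 i - \<nu> i)" using False by (simp add: m_def)
    let ?S = "{\<nu> i<..\<nu>0 i}"
    have "?D = sum (L (i+1) (q (i+1))) ?S - sum (L i (q i)) ?S"
      using False sum_interval_split[of 0 "\<nu> i" "\<nu>0 i"] by simp
    also have "\<dots> = m * \<kappa> i (q i) i - m * \<kappa> (i+1) (q (i+1)) i
        + (\<Sum>t\<in>?S. L (i+1) (q (i+1)) t - \<mu> (i+1) (q (i+1)) t) - (\<Sum>t\<in>?S. L i (q i) t - \<mu> i (q i) t)"
      unfolding dec[of i] dec[of "i+1"]
      using False near g1 mem qq by (subst (1 2) deficit_on_true_segment[where i=i]) (auto simp: m)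
    also have "\<dots> \<le> m * \<kappa> i (q i) i - m * \<kappa> (i+1) (q (i+1)) i + 2 * (\<epsilon> * max m K)"
      using noise_left[of i "q i" i "\<nu> i"] noise_left[of "i+1" "q (i+1)" i "\<nu> i"] mem qq i False
      by (auto simp: m)
    also have "m * \<kappa> i (q i) i - m * \<kappa> (i+1) (q (i+1)) i \<le> - (m * (c / 2))"
    proof -
      have "m * (\<kappa> i (q i) i - \<kappa> (i+1) (q (i+1)) i) \<le> m * (- (c / 2))"
        using own sep m0 by (intro mult_left_mono) auto
      then show ?thesis by (simp add: algebra_simps)
    qed
    finally show ?thesis by simp
  qed
  have "\<epsilon> * max m K \<le> \<epsilon> * (m + K)" using \<epsilon> m0 K by (intro mult_left_mono) auto
  moreover have "\<epsilon> * m \<le> c / 8 * m" using ec m0 by (intro mult_right_mono)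
  ultimately show ?thesis using key unfolding m_def[symmetric] by (simp add: algebra_simps)
qed

text \<open>Here the fit is compared with the true change points combined with the fitted parameters. The
parameters then cancel on the bulk of the sample, so that the bound depends on \<open>K\<close> but not on \<open>n\<close>.\<close>

lemma change_points_close:
  assumes ec: "\<epsilon> \<le> c / 8"
    and beats_own: "(\<Sum>j=1..k+1. sum (L j (q j)) {\<nu>0 (j-1)<..\<nu>0 j})
                    \<le> (\<Sum>j=1..k+1. sum (L j (q j)) {\<nu> (j-1)<..\<nu> j})"
    and i: "i \<in> {1..k}"
  shows "\<bar>real (\<nu> i) - real (\<nu>0 i)\<bar> \<le> 8 * real k * \<epsilon> * K / c"
proof -
  have "0 \<le> (\<Sum>i=1..k. 2 * \<epsilon> * K - c / 4 * \<bar>real (\<nu> i) - real (\<nu>0 i)\<bar>)"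
  proof -
    have "0 \<le> (\<Sum>i=1..k. (sum (L i (q i)) {0<..\<nu> i} - sum (L i (q i)) {0<..\<nu>0 i})
       - (sum (L (i+1) (q (i+1))) {0<..\<nu> i} - sum (L (i+1) (q (i+1))) {0<..\<nu>0 i}))"
      using beats_own segmentation_difference[OF cp cp0, of "\<lambda>j. L j (q j)"] by linarith
    also have "\<dots> \<le> (\<Sum>i=1..k. 2 * \<epsilon> * K - c / 4 * \<bar>real (\<nu> i) - real (\<nu>0 i)\<bar>)"
      using ec by (intro sum_mono relocation_gain)
    finally show ?thesis .
  qed
  then have "c / 4 * (\<Sum>i=1..k. \<bar>real (\<nu> i) - real (\<nu>0 i)\<bar>) \<le> real k * (2 * \<epsilon> * K)"
    by (simp add: sum_subtractf sum_distrib_left)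
  moreover have "c / 4 * \<bar>real (\<nu> i) - real (\<nu>0 i)\<bar> \<le> c / 4 * (\<Sum>i=1..k. \<bar>real (\<nu> i) - real (\<nu>0 i)\<bar>)"
    using c i by (intro mult_left_mono member_le_sum[where f="\<lambda>i. \<bar>real (\<nu> i) - real (\<nu>0 i)\<bar>"]) auto
  ultimately have "c / 4 * \<bar>real (\<nu> i) - real (\<nu>0 i)\<bar> \<le> real k * (2 * \<epsilon> * K)" by linarith
  then show ?thesis using c by (simp add: field_simps)
qed

end

end

section \<open>Uniform control of the log-likelihood noise\<close>

definition tail_bound :: "real \<Rightarrow> real \<Rightarrow> real \<Rightarrow> nat \<Rightarrow> real" where
  "tail_bound C r \<epsilon> h = 80 * C / \<epsilon>\<^sup>2 * (2 powr r / 4) ^ h / (1 - 2 powr r / 4)"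

lemma tail_bound_nonneg: "0 \<le> C \<Longrightarrow> r < 2 \<Longrightarrow> 0 \<le> tail_bound C r \<epsilon> h"
  using powr_less_mono[of r 2 2] by (simp add: tail_bound_def)

lemma tail_bound_tendsto_0:
  assumes "r < 2"
  shows "(\<lambda>h. tail_bound C r \<epsilon> h) \<longlonglongrightarrow> 0"
proof -
  have "(2::real) powr r < 2 powr 2" using assms by (intro powr_less_mono) auto
  then have "(\<lambda>h. (2 powr r / 4) ^ h) \<longlonglongrightarrow> (0::real)"
    by (intro LIMSEQ_realpow_zero) auto
  then have "(\<lambda>h. 80 * C / \<epsilon>\<^sup>2 * (2 powr r / 4) ^ h / (1 - 2 powr r / 4))
      \<longlonglongrightarrow> 80 * C / \<epsilon>\<^sup>2 * 0 / (1 - 2 powr r / 4)"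
    using \<open>2 powr r < 2 powr 2\<close> by (intro tendsto_intros) auto
  then show ?thesis by (simp add: tail_bound_def)
qed

text \<open>The weights 5 and 5/4 are conjugate: they come from \<open>2 u v \<le> 4 u\<^sup>2 + v\<^sup>2 / 4\<close>. They are the ones that
the dyadic recursion needs.\<close>

lemma sup_sq_add_le:
  "sup_sq P (\<lambda>p \<omega>. U p \<omega> + V p \<omega>) \<omega> \<le> 5 * sup_sq P U \<omega> + ennreal (5/4) * sup_sq P V \<omega>"
  unfolding sup_sq_def
proof (rule SUP_least)
  fix p assume p: "p \<in> P"
  have "0 \<le> (4 * U p \<omega> - V p \<omega>)\<^sup>2 / 4" by simp
  then have "(U p \<omega> + V p \<omega>)\<^sup>2 \<le> 5 * (U p \<omega>)\<^sup>2 + 5/4 * (V p \<omega>)\<^sup>2"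
    by (simp add: power2_eq_square field_simps)
  then have "ennreal ((U p \<omega> + V p \<omega>)\<^sup>2) \<le> ennreal (5 * (U p \<omega>)\<^sup>2 + 5/4 * (V p \<omega>)\<^sup>2)"
    by (rule ennreal_leI)
  also have "\<dots> = 5 * ennreal ((U p \<omega>)\<^sup>2) + ennreal (5/4) * ennreal ((V p \<omega>)\<^sup>2)"
    by (subst ennreal_plus) (auto simp: ennreal_mult[of 5] ennreal_mult[of "5/4"] simp del: times_divide_eq_left)
  also have "\<dots> \<le> 5 * (SUP p\<in>P. ennreal ((U p \<omega>)\<^sup>2)) + ennreal (5/4) * (SUP p\<in>P. ennreal ((V p \<omega>)\<^sup>2))"
    using p by (intro add_mono mult_left_mono SUP_upper) auto
  finally show "ennreal ((U p \<omega> + V p \<omega>)\<^sup>2)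
    \<le> 5 * (SUP p\<in>P. ennreal ((U p \<omega>)\<^sup>2)) + ennreal (5/4) * (SUP p\<in>P. ennreal ((V p \<omega>)\<^sup>2))" .
qed

lemma sup_sq_le_imp_abs_le:
  assumes "sup_sq P Z \<omega> \<le> ennreal (x\<^sup>2)" "p \<in> P" "0 \<le> x"
  shows "\<bar>Z p \<omega>\<bar> \<le> x"
proof -
  have "ennreal ((Z p \<omega>)\<^sup>2) \<le> sup_sq P Z \<omega>" unfolding sup_sq_def using assms(2) by (rule SUP_upper)
  also have "\<dots> \<le> ennreal (x\<^sup>2)" by fact
  finally have "(Z p \<omega>)\<^sup>2 \<le> x\<^sup>2" by simp
  then show ?thesis using assms(3) by (metis abs_le_square_iff abs_of_nonneg)
qed

text \<open>The tail bound is applied to the intervals read off from \<open>s\<close> to the right and, reversing the order,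
to the left. Cutting the indices off at \<open>n\<close> and at 0 makes the families total. The argument takes place in
the completion, with respect to which the supremum over an uncountable parameter set is measurable.\<close>

lemma two_sided_deviation:
  fixes W :: "'p \<Rightarrow> nat \<Rightarrow> 'w \<Rightarrow> real"
  assumes mom: "\<And>a b. a < b \<Longrightarrow> b \<le> n \<Longrightarrow>
        E_max_sq_le M P (\<lambda>p \<omega>. \<Sum>i\<in>{a<..b}. W p i \<omega>) (C * real (b - a) powr r)"
    and C: "0 \<le> C" and r: "3/2 \<le> r" "r < 2" and \<epsilon>: "0 < \<epsilon>" and s: "s \<le> n"
  shows "\<exists>B\<in>sets (completion M). emeasure (completion M) B \<le> ennreal (2 * tail_bound C r \<epsilon> h) \<and>
    (\<forall>\<omega>\<in>space M - B. \<forall>p\<in>P.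
      (\<forall>b. s \<le> b \<and> b \<le> n \<longrightarrow> \<bar>\<Sum>i\<in>{s<..b}. W p i \<omega>\<bar> \<le> \<epsilon> * max (real (b - s)) (2 ^ h)) \<and>
      (\<forall>a\<le>s. \<bar>\<Sum>i\<in>{a<..s}. W p i \<omega>\<bar> \<le> \<epsilon> * max (real (s - a)) (2 ^ h)))"
proof -
  define T where "T a b = sup_sq P (\<lambda>p \<omega>. \<Sum>i\<in>{a<..b}. W p i \<omega>)" for a b
  have T0: "T a a \<omega> = 0" for a \<omega>
    by (simp add: T_def sup_sq_def) (metis SUP_bot bot_ennreal)
  have Tmeas: "T a b \<in> borel_measurable (completion M)" if "a \<le> b" "b \<le> n" for a b
  proof (cases "a = b")
    case True
    then have "T a b = (\<lambda>_. 0)" using T0 by auto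
    then show ?thesis by simp
  next
    case False
    then show ?thesis using mom[of a b] that by (simp add: T_def E_max_sq_le_def)
  qed
  have Tint: "(\<integral>\<^sup>+\<omega>. T a b \<omega> \<partial>completion M) \<le> ennreal (C * real d powr r)"
    if "a \<le> b" "b \<le> n" "b - a \<le> d" for a b d
  proof (cases "a = b")
    case True
    then show ?thesis using T0 by simp
  next
    case False
    then have "(\<integral>\<^sup>+\<omega>. T a b \<omega> \<partial>completion M) \<le> ennreal (C * real (b - a) powr r)"
      using mom[of a b] that by (simp add: T_def E_max_sq_le_def nn_integral_completion)
    also have "\<dots> \<le> ennreal (C * real d powr r)"
      using that C r by (intro ennreal_leI mult_left_mono powr_mono2) auto
    finally show ?thesis .
  qed
  have Tadd: "T a c \<omega> \<le> 5 * T a b \<omega> + ennreal (5/4) * T b c \<omega>"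
    and Tadd': "T a c \<omega> \<le> 5 * T b c \<omega> + ennreal (5/4) * T a b \<omega>" if "a \<le> b" "b \<le> c" for a b c \<omega>
    using sup_sq_add_le[of P "\<lambda>p \<omega>. \<Sum>i\<in>{a<..b}. W p i \<omega>" "\<lambda>p \<omega>. \<Sum>i\<in>{b<..c}. W p i \<omega>" \<omega>]
      sup_sq_add_le[of P "\<lambda>p \<omega>. \<Sum>i\<in>{b<..c}. W p i \<omega>" "\<lambda>p \<omega>. \<Sum>i\<in>{a<..b}. W p i \<omega>" \<omega>]
      sum_interval_split[OF that] by (simp_all add: T_def add.commute)
  obtain Br where Br: "Br \<in> sets (completion M)" "emeasure (completion M) Br \<le> ennreal (tail_bound C r \<epsilon> h)"
    "\<forall>\<omega>\<in>space (completion M) - Br. \<forall>t. T (min (s+0) n) (min (s+t) n) \<omega> \<le> ennreal ((\<epsilon> * max (real t) (2 ^ h))\<^sup>2)"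
  proof -
    have "\<exists>B\<in>sets (completion M). emeasure (completion M) B \<le> ennreal (tail_bound C r \<epsilon> h) \<and>
      (\<forall>\<omega>\<in>space (completion M) - B. \<forall>t. T (min (s+0) n) (min (s+t) n) \<omega> \<le> ennreal ((\<epsilon> * max (real t) (2 ^ h))\<^sup>2))"
      unfolding tail_bound_def
      by (rule deviation_tail[of "\<lambda>a b. T (min (s+a) n) (min (s+b) n)"])
        (use C r \<epsilon> in \<open>auto intro!: Tmeas T0 Tadd Tint simp del: of_nat_diff\<close>)
    then show ?thesis using that by blast
  qed
  obtain Bl where Bl: "Bl \<in> sets (completion M)" "emeasure (completion M) Bl \<le> ennreal (tail_bound C r \<epsilon> h)"
    "\<forall>\<omega>\<in>space (completion M) - Bl. \<forall>t. T (s-t) (s-0) \<omega> \<le> ennreal ((\<epsilon> * max (real t) (2 ^ h))\<^sup>2)"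
  proof -
    have "\<exists>B\<in>sets (completion M). emeasure (completion M) B \<le> ennreal (tail_bound C r \<epsilon> h) \<and>
      (\<forall>\<omega>\<in>space (completion M) - B. \<forall>t. T (s-t) (s-0) \<omega> \<le> ennreal ((\<epsilon> * max (real t) (2 ^ h))\<^sup>2))"
      unfolding tail_bound_def
      by (rule deviation_tail[of "\<lambda>a b. T (s-b) (s-a)"])
        (use C r \<epsilon> s in \<open>auto intro!: Tmeas T0 Tadd' Tint simp del: of_nat_diff\<close>)
    then show ?thesis using that by blast
  qed
  show ?thesis
  proof (intro bexI[of _ "Br \<union> Bl"] conjI ballI allI impI)
    have "emeasure (completion M) (Br \<union> Bl) \<le> emeasure (completion M) Br + emeasure (completion M) Bl"
      using Br Bl by (intro emeasure_subadditive) auto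
    also have "\<dots> \<le> ennreal (tail_bound C r \<epsilon> h) + ennreal (tail_bound C r \<epsilon> h)"
      using Br Bl by (intro add_mono) auto
    also have "\<dots> = ennreal (2 * tail_bound C r \<epsilon> h)"
      using tail_bound_nonneg[OF C r(2)] by (simp add: ennreal_plus[symmetric] del: ennreal_plus)
    finally show "emeasure (completion M) (Br \<union> Bl) \<le> ennreal (2 * tail_bound C r \<epsilon> h)" .
    show "Br \<union> Bl \<in> sets (completion M)" using Br Bl by auto
    fix \<omega> p assume \<omega>: "\<omega> \<in> space M - (Br \<union> Bl)" and p: "p \<in> P"
    show "\<bar>\<Sum>i\<in>{s<..b}. W p i \<omega>\<bar> \<le> \<epsilon> * max (real (b - s)) (2 ^ h)" if "s \<le> b \<and> b \<le> n" for b
    proof -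
      have "T (min (s+0) n) (min (s+(b-s)) n) \<omega> \<le> ennreal ((\<epsilon> * max (real (b-s)) (2 ^ h))\<^sup>2)"
        using Br(3) \<omega> by (metis DiffE DiffI UnCI space_completion)
      then have "T s b \<omega> \<le> ennreal ((\<epsilon> * max (real (b-s)) (2 ^ h))\<^sup>2)" using that s by simp
      then show ?thesis unfolding T_def using p
        by (rule sup_sq_le_imp_abs_le) (use \<epsilon> in \<open>simp add: le_max_iff_disj\<close>)
    qed
    show "\<bar>\<Sum>i\<in>{a<..s}. W p i \<omega>\<bar> \<le> \<epsilon> * max (real (s - a)) (2 ^ h)" if "a \<le> s" for a
    proof -
      have "T (s-(s-a)) (s-0) \<omega> \<le> ennreal ((\<epsilon> * max (real (s-a)) (2 ^ h))\<^sup>2)"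
        using Bl(3) \<omega> by (metis DiffE DiffI UnCI space_completion)
      then have "T a s \<omega> \<le> ennreal ((\<epsilon> * max (real (s-a)) (2 ^ h))\<^sup>2)" using that by simp
      then show ?thesis unfolding T_def using p
        by (rule sup_sq_le_imp_abs_le) (use \<epsilon> in \<open>simp add: le_max_iff_disj\<close>)
    qed
  qed
qed

lemma distributed_log_density:
  fixes g h :: "'x::euclidean_space \<Rightarrow> real"
  assumes D: "distributed M lborel Y (\<lambda>x. ennreal (g x))" and g: "prob_density g" and h: "prob_density h"
    and I: "integrable M (\<lambda>\<omega>. ln (h (Y \<omega>)))" and pos: "AE \<omega> in M. 0 < h (Y \<omega>)"
  shows "integrable lborel (\<lambda>x. g x * ln (h x))"
    and "(\<integral>\<omega>. ln (h (Y \<omega>)) \<partial>M) = (\<integral>x. g x * ln (h x) \<partial>lborel)"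
    and "AE x in lborel. 0 < g x \<longrightarrow> 0 < h x"
proof -
  have [measurable]: "h \<in> borel_measurable borel" using h by (simp add: prob_density_def)
  have nn: "0 \<le> g x" for x using g by (simp add: prob_density_def)
  have m: "(\<lambda>x. ln (h x)) \<in> borel_measurable lborel" by measurable
  show "integrable lborel (\<lambda>x. g x * ln (h x))"
    using distributed_integrable[OF D m] nn I by simp
  show "(\<integral>\<omega>. ln (h (Y \<omega>)) \<partial>M) = (\<integral>x. g x * ln (h x) \<partial>lborel)"
    using distributed_integral[OF D m] nn by simp
  have "AE x in distr M lborel Y. 0 < h x"
    using pos distributed_measurable[OF D] by (subst AE_distr_iff) auto
  then have "AE x in lborel. 0 < ennreal (g x) \<longrightarrow> 0 < h x"
    unfolding distributed_distr_eq_density[OF D]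
    using distributed_borel_measurable[OF D] by (subst (asm) AE_density) auto
  then show "AE x in lborel. 0 < g x \<longrightarrow> 0 < h x" by simp
qed

text \<open>Transfers a bound from an exceptional set in the completion to the original measure. The case
distinction is about \<open>A\<close>: the value of \<open>measure\<close> at a set outside the \<open>\<sigma>\<close>-algebra is 0 by convention.\<close>

lemma measure_le_of_almost_everywhere_subset:
  assumes "finite_measure M" and B: "B \<in> sets (completion M)" "emeasure (completion M) B \<le> ennreal \<eta>"
    and "0 \<le> \<eta>" and sub: "AE \<omega> in M. \<omega> \<in> A \<longrightarrow> \<omega> \<in> B"
  shows "measure M A \<le> \<eta>"
proof (cases "A \<in> sets M")
  case True
  interpret finite_measure M by fact
  have "emeasure M A = emeasure (completion M) A" using True by simp
  also have "\<dots> \<le> emeasure (completion M) B"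
    using sub B by (intro emeasure_mono_AE AE_completion) auto
  also have "\<dots> \<le> ennreal \<eta>" by fact
  finally show ?thesis using \<open>0 \<le> \<eta>\<close> by (simp add: emeasure_eq_measure)
next
  case False
  then show ?thesis using \<open>0 \<le> \<eta>\<close> by (simp add: measure_notin_sets)
qed

section \<open>The rate of convergence of the estimated change points\<close>

theorem theorem2p2:
  fixes k d :: nat
    and d\<theta> :: "nat \<Rightarrow> nat"
    and f :: "nat \<Rightarrow> (nat \<Rightarrow> real) \<Rightarrow> (nat \<Rightarrow> real) \<Rightarrow> 'x::euclidean_space \<Rightarrow> real"
    and \<Psi> :: "(nat \<Rightarrow> real) set"
    and \<Theta> :: "nat \<Rightarrow> (nat \<Rightarrow> real) set"
    and \<psi>0 :: "nat \<Rightarrow> real"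
    and \<theta>0 :: "nat \<Rightarrow> nat \<Rightarrow> real"
    and lam0 :: "nat \<Rightarrow> real"
    and N :: "nat set"
    and n0 :: "nat \<Rightarrow> nat \<Rightarrow> nat"
    and M :: "nat \<Rightarrow> 'w measure"
    and X :: "nat \<Rightarrow> nat \<Rightarrow> 'w \<Rightarrow> 'x"
    and nhat :: "nat \<Rightarrow> 'w \<Rightarrow> nat \<Rightarrow> nat"
    and \<psi>hat :: "nat \<Rightarrow> 'w \<Rightarrow> nat \<Rightarrow> real"
    and \<theta>hat :: "nat \<Rightarrow> 'w \<Rightarrow> nat \<Rightarrow> nat \<Rightarrow> real"
  assumes k: "k \<ge> 1"
    (* the model, for the sample sizes n in N *)
    and dens: "\<And>j \<psi> \<theta>. j \<in> {1..k+1} \<Longrightarrow> \<psi> \<in> \<Psi> \<Longrightarrow> \<theta> \<in> \<Theta> j \<Longrightarrow> prob_density (f j \<psi> \<theta>)"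
    and N: "infinite N"
    and true_cp: "\<And>n. n \<in> N \<Longrightarrow> change_points k n (n0 n)"
    and lam0: "\<And>n j. n \<in> N \<Longrightarrow> j \<in> {1..k} \<Longrightarrow> lam0 j = real (n0 n j) / real n"
    and prob: "\<And>n. n \<in> N \<Longrightarrow> prob_space (M n)"
    and indep: "\<And>n. n \<in> N \<Longrightarrow> prob_space.indep_vars (M n) (\<lambda>_. borel) (X n) {1..n}"
    and distr: "\<And>n j i. n \<in> N \<Longrightarrow> j \<in> {1..k+1} \<Longrightarrow> n0 n (j-1) + 1 \<le> i \<Longrightarrow> i \<le> n0 n j \<Longrightarrow>
      distributed (M n) lborel (X n i) (\<lambda>x. ennreal (f j \<psi>0 (\<theta>0 j) x))"
    (* the estimators *)
    and nhat_meas: "\<And>n j. n \<in> N \<Longrightarrow> j \<in> {1..k} \<Longrightarrow>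
      (\<lambda>\<omega>. nhat n \<omega> j) \<in> measurable (M n) (count_space UNIV)"
    and mle: "\<And>n. n \<in> N \<Longrightarrow> AE \<omega> in M n.
      is_MLE k n f \<Psi> \<Theta> (\<lambda>i. X n i \<omega>) (nhat n \<omega>) (\<psi>hat n \<omega>) (\<theta>hat n \<omega>)"
    and A: "\<And>j. j \<in> {1..k} \<Longrightarrow>
      emeasure lborel {x. f (j+1) \<psi>0 (\<theta>0 (j+1)) x \<noteq> f j \<psi>0 (\<theta>0 j) x} \<noteq> 0"
    and B1_psi: "\<Psi> \<subseteq> Rspace d" "compact \<Psi>" "\<psi>0 \<in> \<Psi>"
    and B1_theta: "\<And>j. j \<in> {1..k+1} \<Longrightarrow> \<Theta> j \<subseteq> Rspace (d\<theta> j) \<and> compact (\<Theta> j) \<and> \<theta>0 j \<in> \<Theta> j"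
    (* the log-likelihood is finite (ln is total in HOL, so this has to be said) and C^3 *)
    and B2_finite: "\<And>n. n \<in> N \<Longrightarrow> AE \<omega> in M n.
      \<forall>i\<in>{1..n}. \<forall>j\<in>{1..k+1}. \<forall>\<psi>\<in>\<Psi>. \<forall>\<theta>\<in>\<Theta> j. f j \<psi> \<theta> (X n i \<omega>) > 0"
    and B2: "\<And>n. n \<in> N \<Longrightarrow> AE \<omega> in M n. \<forall>\<nu>. change_points k n \<nu> \<longrightarrow>
      (\<exists>G. Ck_extension 3 (coords k d d\<theta>) (param_space k d d\<theta> \<Psi> \<Theta>)
             (\<lambda>\<phi>. loglik k f (\<lambda>i. X n i \<omega>) \<nu> (psi_of \<phi>) (theta_of \<phi>)) G)"
    and B3: "\<And>n. n \<in> N \<Longrightarrow> \<exists>G.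
      (AE \<omega> in M n. Ck_extension 3 (coords k d d\<theta>) (param_space k d d\<theta> \<Psi> \<Theta>)
             (\<lambda>\<phi>. loglik k f (\<lambda>i. X n i \<omega>) (n0 n) (psi_of \<phi>) (theta_of \<phi>)) (G \<omega>)) \<and>
      (\<forall>\<phi>\<in>param_space k d d\<theta> \<Psi> \<Theta>. \<forall>c\<in>coords k d d\<theta>.
         integrable (M n) (\<lambda>\<omega>. pd c (G \<omega>) \<phi>) \<and>
         (\<forall>c'\<in>coords k d d\<theta>. integrable (M n) (\<lambda>\<omega>. pd c' (pd c (G \<omega>)) \<phi>)))"
    and C1_mean: "\<And>n i j \<psi> \<theta>. n \<in> N \<Longrightarrow> i \<in> {1..n} \<Longrightarrow> j \<in> {1..k+1} \<Longrightarrow> \<psi> \<in> \<Psi> \<Longrightarrow> \<theta> \<in> \<Theta> j \<Longrightarrow>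
      integrable (M n) (\<lambda>\<omega>. ln (f j \<psi> \<theta> (X n i \<omega>)))"
    and C1: "\<exists>C r::real. r < 2 \<and>
      (\<forall>n\<in>N. \<forall>j\<in>{1..k+1}. \<forall>s t. s < t \<and> t \<le> n \<longrightarrow>
         E_max_sq_le (M n) (\<Psi> \<times> \<Theta> j)
           (\<lambda>(\<psi>, \<theta>) \<omega>. \<Sum>i=s+1..t. (ln (f j \<psi> \<theta> (X n i \<omega>))
              - (\<integral>\<omega>'. ln (f j \<psi> \<theta> (X n i \<omega>')) \<partial>M n)))
           (C * real (t - s) powr r))"
    and C2: "\<exists>D r::real. r < 2 \<and>
      (\<forall>n\<in>N. \<forall>j\<in>{1..k+1}. \<forall>s t. n0 n (j-1) \<le> s \<and> s < t \<and> t \<le> n0 n j \<longrightarrow>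
         E_max_sq_le (M n) (\<Psi> \<times> \<Theta> j)
           (\<lambda>(\<psi>, \<theta>) \<omega>. \<Sum>i=s+1..t. ((ln (f j \<psi> \<theta> (X n i \<omega>)) - ln (f j \<psi>0 (\<theta>0 j) (X n i \<omega>)))
              - vdiv f j j \<psi> \<theta> \<psi>0 (\<theta>0 j)))
           (D * real (t - s) powr r))"
  shows "(((\<lambda>\<delta>::real. Limsup (inf sequentially (principal N))
            (\<lambda>n. ereal (measure (M n)
               {\<omega> \<in> space (M n). real n * sup_dist k n (nhat n \<omega>) lam0 \<ge> \<delta>})))
          \<longlongrightarrow> 0) at_top) \<and>
         (\<forall>i\<in>{1..k}. big_Op (inf sequentially (principal N)) M
            (\<lambda>n \<omega>. real (nhat n \<omega> i) / real n - lam0 i) (\<lambda>n. 1 / real n))"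
proof -
  \<comment> \<open>\<open>g\<close>: the true densities; \<open>m j p i\<close>: the expected log-density of model \<open>j\<close> on true segment \<open>i\<close>.\<close>
  define g where "g i = f i \<psi>0 (\<theta>0 i)" for i
  define P where "P j = \<Psi> \<times> \<Theta> j" for j
  define p0 where "p0 j = (\<psi>0, \<theta>0 j)" for j
  define F where "F j p = f j (fst p) (snd p)" for j and p :: "(nat \<Rightarrow> real) \<times> (nat \<Rightarrow> real)"
  define m where "m j p i = (\<integral>x. g i x * ln (F j p x) \<partial>lborel)" for j p i
  define \<kappa> where "\<kappa> j p i = m i (p0 i) i - m j p i" for j p i
  define \<mu> where "\<mu> n j p t = (\<integral>\<omega>. ln (F j p (X n t \<omega>)) \<partial>M n)" for n j p t
  define H where "H u v = (\<integral>x. (sqrt (u x) - sqrt (v x))\<^sup>2 \<partial>lborel)" for u v :: "'x \<Rightarrow> real"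

  have p0_in: "p0 j \<in> P j" if "j \<in> {1..k+1}" for j
    using that B1_psi B1_theta by (auto simp: p0_def P_def)
  have F_dens: "prob_density (F j p)" if "j \<in> {1..k+1}" "p \<in> P j" for j p
    using that dens by (auto simp: F_def P_def)
  have g_F: "g j = F j (p0 j)" for j by (simp add: g_def F_def p0_def)
  have g_dens: "prob_density (g i)" if "i \<in> {1..k+1}" for i
    unfolding g_F using that by (intro F_dens p0_in)

  have seg: "{n0 n (i-1)<..n0 n i} \<subseteq> {1..n}" "n0 n i \<in> {n0 n (i-1)<..n0 n i}"
    if "n \<in> N" "i \<in> {1..k+1}" for n i
    using change_points_le[OF true_cp[OF that(1)], of i "k+1"] change_points_less[OF true_cp[OF that(1)], of "i-1" i]
      true_cp[OF that(1)] that by (auto simp: change_points_def)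

  have logdens: "integrable lborel (\<lambda>x. g i x * ln (F j p x))" "\<mu> n j p t = m j p i"
      "AE x in lborel. 0 < g i x \<longrightarrow> 0 < F j p x"
    if n: "n \<in> N" and i: "i \<in> {1..k+1}" and j: "j \<in> {1..k+1}" and p: "p \<in> P j"
      and t: "t \<in> {n0 n (i-1)<..n0 n i}" for n i j p t
  proof -
    have t': "t \<in> {1..n}" using seg(1)[OF n i] t by blast
    have D: "distributed (M n) lborel (X n t) (\<lambda>x. ennreal (g i x))"
      using distr[OF n i, of t] t by (simp add: g_def)
    have I: "integrable (M n) (\<lambda>\<omega>. ln (F j p (X n t \<omega>)))"
      using C1_mean[OF n t' j, of "fst p" "snd p"] p by (auto simp: F_def P_def)
    have pos: "AE \<omega> in M n. 0 < F j p (X n t \<omega>)"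
      using B2_finite[OF n] by eventually_elim (use t' j p in \<open>auto simp: F_def P_def\<close>)
    note L = distributed_log_density[OF D g_dens[OF i] F_dens[OF j p] I pos]
    show "integrable lborel (\<lambda>x. g i x * ln (F j p x))" "AE x in lborel. 0 < g i x \<longrightarrow> 0 < F j p x"
      using L by auto
    show "\<mu> n j p t = m j p i" unfolding \<mu>_def m_def by (rule L(2))
  qed

  \<comment> \<open>A fixed sample size, which also yields bounds uniform in \<open>n\<close>: every true segment has at least
    one of its \<open>s\<close> observations, so by constancy of the ratios it has at least \<open>n / s\<close> of \<open>n\<close>.\<close>
  obtain s where s: "s \<in> N" using infinite_imp_nonempty[OF N] by blast
  have H_le: "H (g i) (F j p) \<le> \<kappa> j p i" if i: "i \<in> {1..k+1}" and j: "j \<in> {1..k+1}" and p: "p \<in> P j" for i j p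
    unfolding H_def \<kappa>_def m_def g_F[symmetric]
  proof (rule hellinger_le_kl)
    show "integrable lborel (\<lambda>x. g i x * ln (g i x))"
      using logdens(1)[OF s i i p0_in[OF i] seg(2)[OF s i]] by (simp add: g_F)
  qed (use logdens[OF s i j p seg(2)[OF s i]] g_dens F_dens i j p in auto)
  have H_nonneg: "0 \<le> H u v" for u v unfolding H_def by (intro Bochner_Integration.integral_nonneg) simp

  define c where "c = Min ((\<lambda>i. H (g i) (g (i+1)) / 2) ` {1..k})"
  have c_pos: "0 < c"
    unfolding c_def
  proof (subst Min_gr_iff)
    show "\<forall>a\<in>(\<lambda>i. H (g i) (g (i+1)) / 2) ` {1..k}. 0 < a"
      using A g_dens hellinger_pos[of "g _" "g (_ + 1)"] by (auto simp: H_def g_def)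
  qed (use k in auto)
  have c_sep: "c \<le> \<kappa> j p i + \<kappa> j p (i+1)" if j: "j \<in> {1..k+1}" and p: "p \<in> P j" and i: "i \<in> {1..k}" for j p i
  proof -
    have "c \<le> H (g i) (g (i+1)) / 2" unfolding c_def using i by (intro Min_le) auto
    also have "\<dots> \<le> H (g i) (F j p) + H (g (i+1)) (F j p)"
      unfolding H_def using i j p g_dens F_dens by (intro hellinger_quasi_triangle) auto
    also have "\<dots> \<le> \<kappa> j p i + \<kappa> j p (i+1)" using i j p by (intro add_mono H_le) auto
    finally show ?thesis .
  qed

  have s_pos: "0 < s" using change_points_less[OF true_cp[OF s], of 0 "k+1"] true_cp[OF s] by (simp add: change_points_def)
  have gap: "n0 n i + 4 * (n div (4 * s)) \<le> n0 n (i+1)" if n: "n \<in> N" and i: "i \<le> k" for n i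
  proof -
    have n_pos: "0 < n" using change_points_less[OF true_cp[OF n], of 0 "k+1"] true_cp[OF n] by (simp add: change_points_def)
    have same_ratio: "s * n0 n i = n * n0 s i" if "i \<le> k + 1" for i
    proof -
      consider (first) "i = 0" | (last) "i = k + 1" | (inner) "i \<in> {1..k}" using \<open>i \<le> k + 1\<close> by force
      then show ?thesis
      proof cases
        case inner
        have "real (n0 n i) / real n = real (n0 s i) / real s"
          using lam0[OF n inner] lam0[OF s inner] by simp
        then have "real s * real (n0 n i) = real n * real (n0 s i)" using n_pos s_pos by (simp add: field_simps)
        then show ?thesis by (metis of_nat_eq_iff of_nat_mult)
      qed (use true_cp[OF n] true_cp[OF s] in \<open>auto simp: change_points_def\<close>)
    qed
    have "n0 s i + 1 \<le> n0 s (i+1)" using true_cp[OF s] i by (auto simp: change_points_def Suc_le_eq)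
    then have "n * (n0 s i + 1) \<le> n * n0 s (i+1)" by (rule mult_left_mono) simp
    then have "s * n0 n i + n \<le> s * n0 n (i+1)" using same_ratio[of i] same_ratio[of "i+1"] i by simp
    moreover have "4 * s * (n div (4 * s)) \<le> n" by (rule times_div_less_eq_dividend)
    ultimately have "s * (n0 n i + 4 * (n div (4 * s))) \<le> s * n0 n (i+1)" by (simp add: algebra_simps)
    then show ?thesis using s_pos by simp
  qed

  \<comment> \<open>Chosen so that twice the total noise, \<open>8 (k+1) \<epsilon> n\<close>, is at most \<open>c R\<close> for \<open>R = n div (4 s)\<close>, as \<open>n \<le> 8 s R\<close>.\<close>
  define \<epsilon> where "\<epsilon> = c / (64 * real (k+1) * real s)"
  have \<epsilon>_pos: "0 < \<epsilon>" using c_pos s_pos by (simp add: \<epsilon>_def)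
  have \<epsilon>_c: "\<epsilon> \<le> c / 8"
  proof -
    have "8 * 1 \<le> 64 * real (k+1) * real s" using s_pos by (intro mult_mono) auto
    then show ?thesis unfolding \<epsilon>_def using c_pos by (intro divide_left_mono) auto
  qed

  obtain C r where C: "0 \<le> C" and r: "3/2 \<le> r" "r < 2"
    and mom: "\<And>n j a b. n \<in> N \<Longrightarrow> j \<in> {1..k+1} \<Longrightarrow> a < b \<Longrightarrow> b \<le> n \<Longrightarrow>
       E_max_sq_le (M n) (P j) (\<lambda>p \<omega>. \<Sum>i\<in>{a<..b}. ln (F j p (X n i \<omega>)) - \<mu> n j p i) (C * real (b - a) powr r)"
  proof -
    from C1 obtain C r :: real where r: "r < 2"
      and *: "\<forall>n\<in>N. \<forall>j\<in>{1..k+1}. \<forall>a b. a < b \<and> b \<le> n \<longrightarrow>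
         E_max_sq_le (M n) (\<Psi> \<times> \<Theta> j)
           (\<lambda>(\<psi>, \<theta>) \<omega>. \<Sum>i=a+1..b. (ln (f j \<psi> \<theta> (X n i \<omega>))
              - (\<integral>\<omega>'. ln (f j \<psi> \<theta> (X n i \<omega>')) \<partial>M n)))
           (C * real (b - a) powr r)" by blast
    \<comment> \<open>Interval lengths are at least 1, so the exponent may be raised to \<open>3/2\<close>.\<close>
    show ?thesis
    proof (rule that[of "max C 0" "max r (3/2)"])
      fix n j a b assume h: "n \<in> N" "j \<in> {1..k+1}" "a < b" "b \<le> n"
      have "C * real (b - a) powr r \<le> max C 0 * real (b - a) powr max r (3/2)"
        using h by (intro mult_mono powr_mono) auto
      then have le: "ennreal (C * real (b - a) powr r) \<le> ennreal (max C 0 * real (b - a) powr max r (3/2))"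
        by (rule ennreal_leI)
      have eq: "(\<lambda>(\<psi>, \<theta>) \<omega>. \<Sum>i=a+1..b. (ln (f j \<psi> \<theta> (X n i \<omega>)) - (\<integral>\<omega>'. ln (f j \<psi> \<theta> (X n i \<omega>')) \<partial>M n)))
         = (\<lambda>p \<omega>. \<Sum>i\<in>{a<..b}. ln (F j p (X n i \<omega>)) - \<mu> n j p i)"
        by (auto simp: F_def \<mu>_def fun_eq_iff atLeastSucAtMost_greaterThanAtMost)
      show "E_max_sq_le (M n) (P j) (\<lambda>p \<omega>. \<Sum>i\<in>{a<..b}. ln (F j p (X n i \<omega>)) - \<mu> n j p i)
          (max C 0 * real (b - a) powr max r (3/2))"
        using *[rule_format, OF h(1,2) conjI[OF h(3,4)]] le unfolding eq P_def[symmetric] E_max_sq_le_def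
        by (blast intro: order_trans)
    qed (use r in auto)
  qed

  \<comment> \<open>The heart of the statement: change points are missed by more than \<open>\<delta>\<close> with small probability,
    uniformly in large \<open>n\<close>. The sets \<open>E\<close> are arbitrary so that both conclusions are instances.\<close>
  have tight: "\<exists>\<delta>>0. \<forall>\<^sub>F n in inf sequentially (principal N). \<forall>E.
      (\<forall>\<omega>\<in>E. \<omega> \<in> space (M n) \<and> (\<exists>i\<in>{1..k}. \<delta> < \<bar>real (nhat n \<omega> i) - real (n0 n i)\<bar>)) \<longrightarrow> measure (M n) E \<le> \<eta>"
    if \<eta>: "0 < \<eta>" for \<eta> :: real
  proof -
    define I where "I = {1..k+1} \<times> {..k}"
    have I: "finite I" "card I > 0" by (auto simp: I_def)
    have "\<forall>\<^sub>F h in sequentially. tail_bound C r \<epsilon> h < \<eta> / (2 * real (card I))"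
      using tail_bound_tendsto_0[OF r(2)] \<eta> I by (intro order_tendstoD) auto
    then obtain h where h: "tail_bound C r \<epsilon> h < \<eta> / (2 * real (card I))"
      unfolding eventually_sequentially by blast
    define K where "K = (2::real) ^ h"
    define \<delta> where "\<delta> = 8 * real k * \<epsilon> * K / c"
    have \<delta>: "0 < \<delta>" using k c_pos \<epsilon>_pos by (simp add: \<delta>_def K_def)
    have main: "measure (M n) E \<le> \<eta>"
      if n: "n \<in> N" and large: "4 * s \<le> n" "2 ^ h \<le> n"
        and E: "\<forall>\<omega>\<in>E. \<omega> \<in> space (M n) \<and> (\<exists>i\<in>{1..k}. \<delta> < \<bar>real (nhat n \<omega> i) - real (n0 n i)\<bar>)" for n E
    proof -
      interpret prob_space "M n" using prob[OF n] .
      have n0_le: "n0 n l \<le> n" if "l \<le> k" for l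
        using change_points_le[OF true_cp[OF n], of l "k+1"] true_cp[OF n] that by (auto simp: change_points_def)
      define quiet where "quiet x \<omega> \<longleftrightarrow> (\<forall>p\<in>P (fst x).
          (\<forall>b. n0 n (snd x) \<le> b \<and> b \<le> n \<longrightarrow>
             \<bar>\<Sum>i\<in>{n0 n (snd x)<..b}. ln (F (fst x) p (X n i \<omega>)) - \<mu> n (fst x) p i\<bar> \<le> \<epsilon> * max (real (b - n0 n (snd x))) (2 ^ h)) \<and>
          (\<forall>a\<le>n0 n (snd x).
             \<bar>\<Sum>i\<in>{a<..n0 n (snd x)}. ln (F (fst x) p (X n i \<omega>)) - \<mu> n (fst x) p i\<bar> \<le> \<epsilon> * max (real (n0 n (snd x) - a)) (2 ^ h)))"
        for x \<omega>
      have "\<exists>B. B \<in> sets (completion (M n)) \<and> emeasure (completion (M n)) B \<le> ennreal (2 * tail_bound C r \<epsilon> h) \<and>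
        (\<forall>\<omega>\<in>space (M n) - B. quiet x \<omega>)" if x: "x \<in> I" for x
      proof -
        have j: "fst x \<in> {1..k+1}" and l: "n0 n (snd x) \<le> n" using x n0_le by (auto simp: I_def)
        show ?thesis
          using two_sided_deviation[OF mom[OF n j] C r \<epsilon>_pos l, of h] unfolding quiet_def by blast
      qed
      then have "\<forall>x\<in>I. \<exists>B. B \<in> sets (completion (M n)) \<and> emeasure (completion (M n)) B \<le> ennreal (2 * tail_bound C r \<epsilon> h) \<and>
        (\<forall>\<omega>\<in>space (M n) - B. quiet x \<omega>)" by blast
      from bchoice[OF this] obtain B where
        B: "\<And>x. x \<in> I \<Longrightarrow> B x \<in> sets (completion (M n))"
          "\<And>x. x \<in> I \<Longrightarrow> emeasure (completion (M n)) (B x) \<le> ennreal (2 * tail_bound C r \<epsilon> h)"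
        and quiet: "\<And>x \<omega>. x \<in> I \<Longrightarrow> \<omega> \<in> space (M n) - B x \<Longrightarrow> quiet x \<omega>" by blast
      have "emeasure (completion (M n)) (\<Union>x\<in>I. B x) \<le> (\<Sum>x\<in>I. emeasure (completion (M n)) (B x))"
        using I B by (intro emeasure_subadditive_finite) auto
      also have "\<dots> \<le> (\<Sum>x\<in>I. ennreal (2 * tail_bound C r \<epsilon> h))" using B by (intro sum_mono) auto
      also have "\<dots> = ennreal (real (card I) * (2 * tail_bound C r \<epsilon> h))"
        using tail_bound_nonneg[OF C r(2)] by (simp add: ennreal_mult ennreal_of_nat_eq_real_of_nat)
      also have "\<dots> \<le> ennreal \<eta>" using h I by (intro ennreal_leI) (simp add: field_simps)
      finally have UB: "emeasure (completion (M n)) (\<Union>x\<in>I. B x) \<le> ennreal \<eta>" .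
      have good: "\<bar>real (nhat n \<omega> i) - real (n0 n i)\<bar> \<le> \<delta>"
        if \<omega>: "\<omega> \<in> space (M n)" "\<omega> \<notin> (\<Union>x\<in>I. B x)" and i: "i \<in> {1..k}"
          and opt: "is_MLE k n f \<Psi> \<Theta> (\<lambda>i. X n i \<omega>) (nhat n \<omega>) (\<psi>hat n \<omega>) (\<theta>hat n \<omega>)" for \<omega> i
      proof -
        \<comment> \<open>The least \<open>i\<close> with \<open>t \<le> n0 n i\<close> is the true segment of \<open>t\<close>.\<close>
        define \<mu>0 where "\<mu>0 t = (let i = LEAST i. t \<le> n0 n i in m i (p0 i) i)" for t
        interpret controlled_noise k n "n0 n" P "\<lambda>j p t. ln (F j p (X n t \<omega>))" "\<mu> n" \<mu>0 \<kappa> p0 c \<epsilon> K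
        proof
          fix j p i t assume "j \<in> {1..k+1}" "p \<in> P j" "i \<in> {1..k+1}" "t \<in> {n0 n (i-1)<..n0 n i}"
          then show "\<mu> n j p t = \<mu>0 t - \<kappa> j p i"
            using logdens(2)[OF n, of i j p t] segment_index[OF true_cp[OF n], of i t]
            by (simp add: \<mu>0_def \<kappa>_def Let_def)
        next
          fix j p i assume "j \<in> {1..k+1}" "p \<in> P j" "i \<in> {1..k+1}"
          then show "0 \<le> \<kappa> j p i" using H_le[of i j p] H_nonneg[of "g i" "F j p"] by simp
        next
          fix j p l b assume "j \<in> {1..k+1}" "p \<in> P j" "l \<le> k" "n0 n l \<le> b" "b \<le> n"
          then show "\<bar>\<Sum>t\<in>{n0 n l<..b}. ln (F j p (X n t \<omega>)) - \<mu> n j p t\<bar> \<le> \<epsilon> * max (real (b - n0 n l)) K"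
            using quiet[of "(j, l)" \<omega>] \<omega> by (simp add: I_def K_def quiet_def)
        next
          fix j p l a assume "j \<in> {1..k+1}" "p \<in> P j" "l \<le> k" "a \<le> n0 n l"
          then show "\<bar>\<Sum>t\<in>{a<..n0 n l}. ln (F j p (X n t \<omega>)) - \<mu> n j p t\<bar> \<le> \<epsilon> * max (real (n0 n l - a)) K"
            using quiet[of "(j, l)" \<omega>] \<omega> by (simp add: I_def K_def quiet_def)
        next
          show "K \<le> real n" using large(2) unfolding K_def by (metis of_nat_le_iff of_nat_numeral of_nat_power)
        qed (use true_cp[OF n] p0_in c_sep c_pos \<epsilon>_pos in \<open>auto simp: \<kappa>_def K_def\<close>)
        define q where "q j = (\<psi>hat n \<omega>, \<theta>hat n \<omega> j)" for j
        have ll: "loglik k f (\<lambda>i. X n i \<omega>) \<nu> \<psi> \<theta>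
           = (\<Sum>j=1..k+1. \<Sum>t\<in>{\<nu> (j-1)<..\<nu> j}. ln (F j (\<psi>, \<theta> j) (X n t \<omega>)))" for \<nu> \<psi> \<theta>
          by (simp add: loglik_def F_def atLeastSucAtMost_greaterThanAtMost)
        have cp: "change_points k n (nhat n \<omega>)" and q: "\<And>j. j \<in> {1..k+1} \<Longrightarrow> q j \<in> P j"
          using opt by (auto simp: is_MLE_def q_def P_def)
        have max: "loglik k f (\<lambda>i. X n i \<omega>) (n0 n) \<psi> \<theta> \<le> loglik k f (\<lambda>i. X n i \<omega>) (nhat n \<omega>) (\<psi>hat n \<omega>) (\<theta>hat n \<omega>)"
          if "\<psi> \<in> \<Psi>" "\<forall>j\<in>{1..k+1}. \<theta> j \<in> \<Theta> j" for \<psi> \<theta>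
          using opt that true_cp[OF n] by (auto simp: is_MLE_def)
        define R where "R = n div (4 * s)"
        have R1: "1 \<le> R" using large(1) s_pos by (simp add: R_def Suc_le_eq div_greater_zero_iff)
        have Rn: "real n \<le> 8 * real s * real R"
        proof -
          have "n = 4 * s * R + n mod (4 * s)" by (simp add: R_def)
          also have "\<dots> \<le> 4 * s * R + 4 * s * 1" using s_pos by (intro add_mono) (auto intro: less_imp_le)
          also have "\<dots> \<le> 4 * s * R + 4 * s * R" using R1 by (intro add_mono mult_left_mono) auto
          finally have "n \<le> 8 * s * R" by (simp add: algebra_simps)
          then have "real n \<le> real (8 * s * R)" by (simp only: of_nat_le_iff)
          then show ?thesis by simp
        qed
        have "\<bar>real (nhat n \<omega> i) - real (n0 n i)\<bar> \<le> 8 * real k * \<epsilon> * K / c"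
        proof (rule change_points_close[where q=q and R=R, OF cp q])
          show "(\<Sum>j=1..k+1. \<Sum>t\<in>{n0 n (j-1)<..n0 n j}. ln (F j (p0 j) (X n t \<omega>)))
             \<le> (\<Sum>j=1..k+1. \<Sum>t\<in>{nhat n \<omega> (j-1)<..nhat n \<omega> j}. ln (F j (q j) (X n t \<omega>)))"
            using max[of \<psi>0 \<theta>0] B1_psi B1_theta unfolding ll p0_def q_def by blast
          show "(\<Sum>j=1..k+1. \<Sum>t\<in>{n0 n (j-1)<..n0 n j}. ln (F j (q j) (X n t \<omega>)))
             \<le> (\<Sum>j=1..k+1. \<Sum>t\<in>{nhat n \<omega> (j-1)<..nhat n \<omega> j}. ln (F j (q j) (X n t \<omega>)))"
            using max[of "\<psi>hat n \<omega>" "\<theta>hat n \<omega>"] opt unfolding ll q_def by (auto simp: is_MLE_def)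
          have "8 * real (k+1) * \<epsilon> * real n \<le> 8 * real (k+1) * \<epsilon> * (8 * real s * real R)"
            using Rn \<epsilon>_pos by (intro mult_left_mono) auto
          also have "\<dots> = (64 * real (k+1) * real s * \<epsilon>) * real R" by simp
          also have "64 * real (k+1) * real s * \<epsilon> = c"
          proof -
            have "64 * real (k+1) * real s \<noteq> 0" using s_pos by auto
            then show ?thesis unfolding \<epsilon>_def times_divide_eq_right by (rule nonzero_mult_div_cancel_left)
          qed
          finally show "8 * real (k+1) * \<epsilon> * real n \<le> c * real R" .
          show "\<And>i. i \<le> k \<Longrightarrow> n0 n i + 4 * R \<le> n0 n (i+1)" using gap[OF n] by (simp add: R_def)
        qed (use R1 \<epsilon>_c i in auto)
        then show ?thesis by (simp add: \<delta>_def)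
      qed
      show ?thesis
      proof (rule measure_le_of_almost_everywhere_subset[OF _ _ UB])
        show "finite_measure (M n)" by unfold_locales
        show "(\<Union>x\<in>I. B x) \<in> sets (completion (M n))" using I B by auto
        show "AE \<omega> in M n. \<omega> \<in> E \<longrightarrow> \<omega> \<in> (\<Union>x\<in>I. B x)"
          using mle[OF n] by eventually_elim (use E good in \<open>fastforce simp: not_less[symmetric]\<close>)
      qed (use \<eta> in simp)
    qed
    have "\<forall>\<^sub>F n in inf sequentially (principal N). n \<in> N \<and> 4 * s \<le> n \<and> 2 ^ h \<le> n"
      unfolding eventually_inf_principal eventually_sequentially
      by (intro exI[of _ "max (4 * s) (2 ^ h)"]) auto
    then have "\<forall>\<^sub>F n in inf sequentially (principal N). \<forall>E.
      (\<forall>\<omega>\<in>E. \<omega> \<in> space (M n) \<and> (\<exists>i\<in>{1..k}. \<delta> < \<bar>real (nhat n \<omega> i) - real (n0 n i)\<bar>)) \<longrightarrow> measure (M n) E \<le> \<eta>"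
      by eventually_elim (use main in blast)
    then show ?thesis using \<delta> by blast
  qed

  have inN: "\<forall>\<^sub>F n in inf sequentially (principal N). n \<in> N \<and> 0 < n"
    unfolding eventually_inf_principal eventually_sequentially by (intro exI[of _ 1]) auto
  have scale: "\<bar>real a / real n - lam0 i\<bar> * real n = \<bar>real a - real (n0 n i)\<bar>"
    if "n \<in> N" "0 < n" "i \<in> {1..k}" for a n i
  proof -
    have "\<bar>real a / real n - lam0 i\<bar> * real n = \<bar>(real a / real n - lam0 i) * real n\<bar>"
      by (simp add: abs_mult)
    also have "(real a / real n - lam0 i) * real n = real a - real (n0 n i)"
      using that by (simp add: lam0 field_simps)
    finally show ?thesis .
  qed

  let ?L = "\<lambda>\<delta>::real. Limsup (inf sequentially (principal N))
            (\<lambda>n. ereal (measure (M n) {\<omega> \<in> space (M n). real n * sup_dist k n (nhat n \<omega>) lam0 \<ge> \<delta>}))"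
  have L_nonneg: "0 \<le> ?L \<delta>" for \<delta>
  proof (rule le_Limsup)
    have "\<exists>n\<ge>m. n \<in> N" for m using N by (meson finite_nat_set_iff_bounded not_le)
    then show "inf sequentially (principal N) \<noteq> bot"
      unfolding trivial_limit_def eventually_inf_principal eventually_sequentially by auto
  qed simp
  have L_small: "\<forall>\<^sub>F \<delta> in at_top. ?L \<delta> \<le> ereal \<eta>" if \<eta>: "0 < \<eta>" for \<eta>
  proof -
    obtain \<delta>0 where \<delta>0: "\<forall>\<^sub>F n in inf sequentially (principal N). \<forall>E.
      (\<forall>\<omega>\<in>E. \<omega> \<in> space (M n) \<and> (\<exists>i\<in>{1..k}. \<delta>0 < \<bar>real (nhat n \<omega> i) - real (n0 n i)\<bar>)) \<longrightarrow> measure (M n) E \<le> \<eta>"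
      using tight[OF \<eta>] by blast
    have "?L \<delta> \<le> ereal \<eta>" if \<delta>: "\<delta>0 < \<delta>" for \<delta>
    proof (rule Limsup_bounded)
      show "\<forall>\<^sub>F n in inf sequentially (principal N).
        ereal (measure (M n) {\<omega> \<in> space (M n). real n * sup_dist k n (nhat n \<omega>) lam0 \<ge> \<delta>}) \<le> ereal \<eta>"
        using \<delta>0 inN
      proof eventually_elim
        case (elim n)
        have "\<exists>i\<in>{1..k}. \<delta>0 < \<bar>real (nhat n \<omega> i) - real (n0 n i)\<bar>"
          if "\<delta> \<le> real n * sup_dist k n (nhat n \<omega>) lam0" for \<omega>
        proof -
          have "sup_dist k n (nhat n \<omega>) lam0 \<in> (\<lambda>j. \<bar>real (nhat n \<omega> j) / real n - lam0 j\<bar>) ` {1..k}"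
            unfolding sup_dist_def using k by (intro Max_in) auto
          then obtain i where i: "i \<in> {1..k}" "sup_dist k n (nhat n \<omega>) lam0 = \<bar>real (nhat n \<omega> i) / real n - lam0 i\<bar>"
            by auto
          then have "real n * sup_dist k n (nhat n \<omega>) lam0 = \<bar>real (nhat n \<omega> i) - real (n0 n i)\<bar>"
            using scale[of n i "nhat n \<omega> i"] elim by (simp add: mult.commute)
          then show ?thesis using i that \<delta> by (intro bexI[of _ i]) auto
        qed
        then show ?case using elim(1) by auto
      qed
    qed
    then show ?thesis by (intro eventually_mono[OF eventually_gt_at_top[of \<delta>0]])
  qed
  have "(?L \<longlongrightarrow> 0) at_top"
  proof (rule order_tendstoI)
    fix a :: ereal assume "a < 0"
    then show "\<forall>\<^sub>F \<delta> in at_top. a < ?L \<delta>" using L_nonneg by (intro always_eventually allI) (rule less_le_trans)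
  next
    fix a :: ereal assume "0 < a"
    then obtain \<eta> where "0 < ereal \<eta>" "ereal \<eta> < a" using ereal_dense2 by blast
    then show "\<forall>\<^sub>F \<delta> in at_top. ?L \<delta> < a"
      by (intro eventually_mono[OF L_small[of \<eta>]]) (auto intro: le_less_trans)
  qed
  moreover have "big_Op (inf sequentially (principal N)) M
            (\<lambda>n \<omega>. real (nhat n \<omega> i) / real n - lam0 i) (\<lambda>n. 1 / real n)" if i: "i \<in> {1..k}" for i
    unfolding big_Op_def
  proof (intro allI impI)
    fix \<eta> :: real assume "0 < \<eta>"
    then obtain \<delta>0 where \<delta>0: "\<forall>\<^sub>F n in inf sequentially (principal N). \<forall>E.
      (\<forall>\<omega>\<in>E. \<omega> \<in> space (M n) \<and> (\<exists>i\<in>{1..k}. \<delta>0 < \<bar>real (nhat n \<omega> i) - real (n0 n i)\<bar>)) \<longrightarrow> measure (M n) E \<le> \<eta> / 2"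
      using tight[of "\<eta> / 2"] by auto
    have "\<forall>\<^sub>F n in inf sequentially (principal N).
        measure (M n) {\<omega> \<in> space (M n). \<bar>real (nhat n \<omega> i) / real n - lam0 i\<bar> > \<delta>0 * (1 / real n)} < \<eta>"
      using \<delta>0 inN
    proof eventually_elim
      case (elim n)
      have "\<delta>0 < \<bar>real (nhat n \<omega> i) - real (n0 n i)\<bar>"
        if "\<bar>real (nhat n \<omega> i) / real n - lam0 i\<bar> > \<delta>0 * (1 / real n)" for \<omega>
        using that scale[of n i "nhat n \<omega> i"] elim i by (simp add: field_simps)
      then have "measure (M n) {\<omega> \<in> space (M n). \<bar>real (nhat n \<omega> i) / real n - lam0 i\<bar> > \<delta>0 * (1 / real n)} \<le> \<eta> / 2"
        using i by (intro elim(1)[rule_format] conjI bexI[of _ i]) auto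
      then show ?case using \<open>0 < \<eta>\<close> by simp
    qed
    then show "\<exists>K. \<forall>\<^sub>F n in inf sequentially (principal N).
        measure (M n) {\<omega> \<in> space (M n). \<bar>real (nhat n \<omega> i) / real n - lam0 i\<bar> > K * (1 / real n)} < \<eta>" by blast
  qed
  ultimately show ?thesis by blast
qed

end
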